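(* Let $\rho$ be an algebraic number, $d\ge 1$, let $\phi$ be a $\mathbb{Z}[\rho]$-linear automorphism of $\mathbb{Z}[\rho]^d$, and let $G=\mathbb{Z}[\rho]^d\rtimes_\phi\mathbb{Z}$, assumed to be finitely generated. If the characteristic polynomial $p_\phi$ of $\phi$ has a multiple in $\mathbb{Z}[t,t^{-1}]$ with property (EDP), then there exist adapted random walks on $G$ with escape exponent $1/2$.
   Context: $G=\mathbb{Z}[\rho]^d\rtimes_\phi\mathbb{Z}$ has multiplication $(\mathbf v,m)(\mathbf w,n)=(\mathbf v+\phi^m\mathbf w,\,m+n)$. A multiple of $p_\phi$ in $\mathbb{Z}[t,t^{-1}]$ means a Laurent polynomial with integer coefficients that is divisible by $p_\phi$ in $\mathbb{C}[t,t^{-1}]$. Property (EDP): for $p=\sum_i p_it^i\in\mathbb{Z}[t,t^{-1}]$ with at least two nonzero coefficients, let $\max^{(1)}_i|p_i|\ge \max^{(2)}_i|p_i|$ be the largest and second largest of the numbers $|p_i|$, counted with multiplicity. Then $p$ has property (EDP) if $$\textstyle\max^{(1)}_i|p_i|\left(1+\frac{1}{\max^{(2)}_i|p_i|}\right)>\sum_i|p_i|.$$ Adapted random walk: $X_0=e$, $X_n=\xi_1\cdots\xi_n$ with $\xi_i$ i.i.d. of law $\mu$, where $\mu(g)=\mu(g^{-1})$ for all $g$ and the support of $\mu$ is a finite generating set of the finitely generated group $G$. $|\cdot|_G$ denotes the word length for some fixed finite symmetric generating set of $G$. Escape exponent: a random walk $X_n$ on $G$ with law $\mu$ has escape exponent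 $\alpha$ if all three of the following hold. (i) ($\alpha$-tight degree of escape) There exist $\gamma,\delta>0$ such that $P(|X_n|_G>\gamma n^\alpha)\ge\delta$ for all $n\ge 1$; and there exist $\beta,c,C>0$ such that $P(|X_n|_G>xn^\alpha)\le C\exp(-cx^\beta)$ for all $x\ge 0$ and all $n\ge 0$. (ii) (Displacement exponent $\alpha$) $\mathbb{E}_\mu|X_n|_G\simeq n^\alpha$, where $f\preceq g$ means there is $c>0$ with $f(x)\le c\,g(cx)$ for all $x\ge 0$ (functions on $\mathbb{N}$ being extended piecewise linearly), and $f\simeq g$ means $f\preceq g$ and $g\preceq f$. (iii) ($\alpha$-law of iterated logarithm) $0<\limsup_{n\to\infty}\frac{|X_n|_G}{(n\log\log n)^\alpha}<\infty$ almost surely. *)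

theory Defs
  imports
    "HOL-Probability.Probability"
    "HOL-Library.Poly_Mapping"
    "HOL-Algebra.Generated_Groups"
    "Jordan_Normal_Form.Char_Poly"
begin

section \<open>The module \<open>\<int>[\<rho>]\<^sup>d\<close> and its automorphisms\<close>

definition int_adjoin :: "complex \<Rightarrow> complex set" where
  "int_adjoin \<rho> = {poly (map_poly of_int p) \<rho> | p :: int poly. True}"

definition free_mod :: "complex \<Rightarrow> nat \<Rightarrow> complex Matrix.vec set" where
  "free_mod \<rho> d = {v \<in> carrier_vec d. \<forall>i<d. vec_index v i \<in> int_adjoin \<rho>}"

text \<open>Only the values of \<open>\<phi>\<close> on \<open>free_mod \<rho> d\<close> matter, here and in all definitions below.\<close>

definition linear_automorphism ::
    "complex \<Rightarrow> nat \<Rightarrow> (complex Matrix.vec \<Rightarrow> complex Matrix.vec) \<Rightarrow> bool" where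
  "linear_automorphism \<rho> d \<phi> \<longleftrightarrow>
     bij_betw \<phi> (free_mod \<rho> d) (free_mod \<rho> d) \<and>
     (\<forall>v \<in> free_mod \<rho> d. \<forall>w \<in> free_mod \<rho> d. \<phi> (v + w) = \<phi> v + \<phi> w) \<and>
     (\<forall>a \<in> int_adjoin \<rho>. \<forall>v \<in> free_mod \<rho> d. \<phi> (a \<cdot>\<^sub>v v) = a \<cdot>\<^sub>v \<phi> v)"

definition matrix_of :: "nat \<Rightarrow> (complex Matrix.vec \<Rightarrow> complex Matrix.vec) \<Rightarrow> complex mat" where
  "matrix_of d \<phi> = Matrix.mat d d (\<lambda>(i, j). vec_index (\<phi> (unit_vec d j)) i)"

definition char_poly_of :: "nat \<Rightarrow> (complex Matrix.vec \<Rightarrow> complex Matrix.vec) \<Rightarrow> complex poly" where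
  "char_poly_of d \<phi> = char_poly (matrix_of d \<phi>)"

definition int_iterate :: "'a set \<Rightarrow> ('a \<Rightarrow> 'a) \<Rightarrow> int \<Rightarrow> 'a \<Rightarrow> 'a" where
  "int_iterate A f m = (if 0 \<le> m then f ^^ nat m else inv_into A f ^^ nat (- m))"

definition semidirect ::
    "complex \<Rightarrow> nat \<Rightarrow> (complex Matrix.vec \<Rightarrow> complex Matrix.vec) \<Rightarrow> (complex Matrix.vec \<times> int) monoid" where
  "semidirect \<rho> d \<phi> =
     \<lparr> carrier = free_mod \<rho> d \<times> UNIV,
       monoid.mult = (\<lambda>(v, m) (w, n). (v + int_iterate (free_mod \<rho> d) \<phi> m w, m + n)),
       one = (0\<^sub>v d, 0) \<rparr>"

section \<open>Laurent polynomials and property (EDP)\<close>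

text \<open>
  \<open>R[t,t\<^sup>-\<^sup>1]\<close> is the type \<open>int \<Rightarrow>\<^sub>0 R\<close> of finitely supported functions, whose library
  multiplication is convolution; the relation \<open>dvd\<close> below is divisibility in \<open>\<complex>[t,t\<^sup>-\<^sup>1]\<close>.
\<close>

definition laurent_of_poly :: "complex poly \<Rightarrow> int \<Rightarrow>\<^sub>0 complex" where
  "laurent_of_poly p = (\<Sum>i\<le>degree p. Poly_Mapping.single (int i) (poly.coeff p i))"

definition integral_multiple :: "complex poly \<Rightarrow> (int \<Rightarrow>\<^sub>0 int) \<Rightarrow> bool" where
  "integral_multiple p q \<longleftrightarrow> laurent_of_poly p dvd Poly_Mapping.map of_int q"

definition EDP :: "(int \<Rightarrow>\<^sub>0 int) \<Rightarrow> bool" where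
  "EDP p \<longleftrightarrow> card (Poly_Mapping.keys p) \<ge> 2 \<and>
    (let N = image_mset (\<lambda>i. \<bar>Poly_Mapping.lookup p i\<bar>) (mset_set (Poly_Mapping.keys p));
         max1 = Max_mset N;
         max2 = Max_mset (N - {#max1#})
     in real_of_int max1 * (1 + 1 / real_of_int max2) > real_of_int (\<Sum>\<^sub># N))"

section \<open>Word length and adapted random walks\<close>

definition sym_gen_set :: "('g, 'm) monoid_scheme \<Rightarrow> 'g set \<Rightarrow> bool" where
  "sym_gen_set G S \<longleftrightarrow> finite S \<and> S \<subseteq> carrier G \<and> (\<forall>s\<in>S. inv\<^bsub>G\<^esub> s \<in> S) \<and> generate G S = carrier G"

definition fin_generated :: "('g, 'm) monoid_scheme \<Rightarrow> bool" where
  "fin_generated G \<longleftrightarrow> (\<exists>S. finite S \<and> S \<subseteq> carrier G \<and> generate G S = carrier G)"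

definition word_length :: "('g, 'm) monoid_scheme \<Rightarrow> 'g set \<Rightarrow> 'g \<Rightarrow> nat" where
  "word_length G S g =
     (LEAST n. \<exists>ws. set ws \<subseteq> S \<and> length ws = n \<and> foldr (\<lambda>x y. x \<otimes>\<^bsub>G\<^esub> y) ws \<one>\<^bsub>G\<^esub> = g)"

definition adapted :: "('g, 'm) monoid_scheme \<Rightarrow> 'g pmf \<Rightarrow> bool" where
  "adapted G \<mu> \<longleftrightarrow> finite (set_pmf \<mu>) \<and> set_pmf \<mu> \<subseteq> carrier G \<and>
     generate G (set_pmf \<mu>) = carrier G \<and>
     (\<forall>g \<in> carrier G. pmf \<mu> g = pmf \<mu> (inv\<^bsub>G\<^esub> g))"

text \<open>
  The increments are the coordinates \<open>\<omega> i\<close> of the infinite product of copies of \<open>\<mu>\<close>.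
  The factors are restricted to the carrier, which for the groups above is countable: products over
  the whole (uncountable) element type would not make the partial products measurable.
\<close>

definition increment_space :: "('g, 'm) monoid_scheme \<Rightarrow> 'g pmf \<Rightarrow> (nat \<Rightarrow> 'g) measure" where
  "increment_space G \<mu> = (\<Pi>\<^sub>M i\<in>UNIV. restrict_space (measure_pmf \<mu>) (carrier G))"

primrec walk :: "('g, 'm) monoid_scheme \<Rightarrow> nat \<Rightarrow> (nat \<Rightarrow> 'g) \<Rightarrow> 'g" where
  "walk G 0 \<omega> = \<one>\<^bsub>G\<^esub>"
| "walk G (Suc n) \<omega> = walk G n \<omega> \<otimes>\<^bsub>G\<^esub> \<omega> n"

section \<open>Escape exponents\<close>

text \<open>Piecewise linear extension to \<open>[0,\<infinity>)\<close>.\<close>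

definition pl_extend :: "(nat \<Rightarrow> real) \<Rightarrow> real \<Rightarrow> real" where
  "pl_extend f x =
     (let k = nat \<lfloor>x\<rfloor> in f k + (x - real k) * (f (Suc k) - f k))"

definition growth_le :: "(nat \<Rightarrow> real) \<Rightarrow> (nat \<Rightarrow> real) \<Rightarrow> bool" where
  "growth_le f g \<longleftrightarrow> (\<exists>c>0. \<forall>x\<ge>0. pl_extend f x \<le> c * pl_extend g (c * x))"

definition growth_equiv :: "(nat \<Rightarrow> real) \<Rightarrow> (nat \<Rightarrow> real) \<Rightarrow> bool" where
  "growth_equiv f g \<longleftrightarrow> growth_le f g \<and> growth_le g f"

definition tight_degree_of_escape :: "'w measure \<Rightarrow> (nat \<Rightarrow> 'w \<Rightarrow> nat) \<Rightarrow> real \<Rightarrow> bool" where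
  "tight_degree_of_escape M L \<alpha> \<longleftrightarrow>
     (\<exists>\<gamma> \<delta>. \<gamma> > 0 \<and> \<delta> > 0 \<and>
        (\<forall>n\<ge>1. measure M {\<omega> \<in> space M. real (L n \<omega>) > \<gamma> * real n powr \<alpha>} \<ge> \<delta>)) \<and>
     (\<exists>\<beta> c C. \<beta> > 0 \<and> c > 0 \<and> C > 0 \<and>
        (\<forall>x\<ge>0. \<forall>n. measure M {\<omega> \<in> space M. real (L n \<omega>) > x * real n powr \<alpha>}
                    \<le> C * exp (- c * x powr \<beta>)))"

definition displacement_exponent :: "'w measure \<Rightarrow> (nat \<Rightarrow> 'w \<Rightarrow> nat) \<Rightarrow> real \<Rightarrow> bool" where
  "displacement_exponent M L \<alpha> \<longleftrightarrow>
     growth_equiv (\<lambda>n. \<integral>\<omega>. real (L n \<omega>) \<partial>M) (\<lambda>n. real n powr \<alpha>)"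

definition iterated_log_law :: "'w measure \<Rightarrow> (nat \<Rightarrow> 'w \<Rightarrow> nat) \<Rightarrow> real \<Rightarrow> bool" where
  "iterated_log_law M L \<alpha> \<longleftrightarrow>
     (AE \<omega> in M.
        0 < limsup (\<lambda>n. ereal (real (L n \<omega>) / (real n * ln (ln (real n))) powr \<alpha>)) \<and>
        limsup (\<lambda>n. ereal (real (L n \<omega>) / (real n * ln (ln (real n))) powr \<alpha>)) < \<infinity>)"

text \<open>The property does not depend on the generating set, so it is asked for all of them.\<close>

definition has_escape_exponent :: "('g, 'm) monoid_scheme \<Rightarrow> 'g pmf \<Rightarrow> real \<Rightarrow> bool" where
  "has_escape_exponent G \<mu> \<alpha> \<longleftrightarrow>
     (\<forall>S. sym_gen_set G S \<longrightarrow>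
        (let M = increment_space G \<mu>; L = (\<lambda>n \<omega>. word_length G S (walk G n \<omega>))
         in tight_degree_of_escape M L \<alpha> \<and> displacement_exponent M L \<alpha> \<and> iterated_log_law M L \<alpha>))"

end

theory Submission
  imports Defs "HOL-Real_Asymp.Real_Asymp"
begin

text \<open>
  Every adapted walk works. Projecting to \<open>\<int>\<close> gives a centred walk \<open>S\<close> with bounded steps, and the
  word length of \<open>X\<^sub>n\<close> is at least a multiple of \<open>\<bar>S\<^sub>n\<bar>\<close>. Conversely, the module component of \<open>X\<^sub>n\<close> is a
  sum of \<open>c\<^sub>f\<^sub>,\<^sub>k \<phi>\<^sup>k f\<close> with \<open>f\<close> in a finite set, \<open>\<bar>k\<bar> \<le> R = max\<^sub>i\<^sub>\<le>\<^sub>n \<bar>S\<^sub>i\<bar>\<close> and digits \<open>\<bar>c\<^sub>f\<^sub>,\<^sub>k\<bar> \<le> n\<close>.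
  Property (EDP) gives an annihilating Laurent polynomial with one coefficient larger than the sum of
  the absolute values of the others. Carrying with this relation multiplies large digits by a factor
  less than one and widens the support by a constant, so after about \<open>\<surd>n\<close> rounds the digits are bounded
  and the support has size \<open>O(R + \<surd>n)\<close>; a Horner sweep then writes \<open>X\<^sub>n\<close> with \<open>O(R + \<surd>n)\<close> letters.
  Thus all three claims reduce to classical estimates for \<open>S\<close> and its maximum.
\<close>

section \<open>Bounded centred random walks on the line\<close>

text \<open>The estimate of the word length is pathwise: it sees the sample only through n and the
  range R, so probability enters only for a walk on the line. A multiple of p_phi comes with a
  cofactor over the complex numbers, which cannot act on Z[rho]^d. Relations are therefore read on
  the coordinate sequences k -> (phi^k v)_l, where every complex Laurent polynomial acts by shifts;
  Cayley-Hamilton is proved in this form and yields the annihilation. The same carried digits must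
  serve all coordinates at once, hence carrying manipulates digits alone and never refers to a
  vector. About log n rounds would already tame digits of size n; sqrt n rounds are affordable
  because every claim lives on the scale sqrt n or above it. On the probabilistic side the constants
  must be uniform in n, and the lower bound must have a definite sign, since in the law of the
  iterated logarithm the contributions of many blocks have to add up rather than cancel. A moment
  inequality with a quartic polynomial delivers this for every finite nonempty set of
  increments.\<close>

locale centred_walk = prob_space +
  fixes X :: "nat \<Rightarrow> 'a \<Rightarrow> real" and K v :: real
  assumes indep: "indep_vars (\<lambda>_. borel) X UNIV"
    and bounded: "AE x in M. \<bar>X i x\<bar> \<le> K"
    and K_pos: "K > 0"
    and mean: "expectation (X i) = 0"
    and variance: "expectation (\<lambda>x. (X i x)\<^sup>2) = v"
    and v_pos: "v > 0"
begin

lemma measurable_X [measurable]: "X i \<in> borel_measurable M"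
  using indep by (auto simp: indep_vars_def)

lemma bounded_sum:
  assumes "finite I"
  shows "AE x in M. \<bar>\<Sum>i\<in>I. X i x\<bar> \<le> K * card I"
proof -
  have "AE x in M. \<forall>i\<in>I. \<bar>X i x\<bar> \<le> K"
    using assms bounded by (simp add: AE_finite_all)
  then show ?thesis
  proof eventually_elim
    case (elim x)
    have "\<bar>\<Sum>i\<in>I. X i x\<bar> \<le> (\<Sum>i\<in>I. \<bar>X i x\<bar>)" by (rule sum_abs)
    also have "\<dots> \<le> (\<Sum>i\<in>I. K)" using elim by (intro sum_mono) auto
    finally show ?case by (simp add: mult.commute)
  qed
qed

text \<open>A continuous function is bounded on a compact interval that almost surely contains the
  values of \<open>Y\<close>. This settles integrability of all powers and exponentials of sums
  below.\<close>

lemma integrable_continuous_bounded: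
  fixes f :: "real \<Rightarrow> real"
  assumes [measurable]: "Y \<in> borel_measurable M" and "AE x in M. \<bar>Y x\<bar> \<le> B" "continuous_on UNIV f"
  shows "integrable M (\<lambda>x. f (Y x))"
proof -
  have "compact (f ` {-B..B})"
    using assms(3) by (intro compact_continuous_image) (auto intro: continuous_on_subset)
  then obtain C where "\<And>y. y \<in> {-B..B} \<Longrightarrow> norm (f y) \<le> C"
    by (meson bounded_iff compact_imp_bounded image_eqI)
  then have C: "norm (f y) \<le> C" if "\<bar>y\<bar> \<le> B" for y
    using that by (simp add: abs_le_iff)
  have [measurable]: "f \<in> borel_measurable borel"
    using assms(3) by (rule borel_measurable_continuous_onI)
  show ?thesis
    by (rule integrable_const_bound[where B = C]) (use assms(2) C in \<open>auto elim!: eventually_mono simp del: real_norm_def\<close>)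
qed

lemma uminus_walk: "centred_walk M (\<lambda>i x. - X i x) K v"
proof
  show "indep_vars (\<lambda>_. borel) (\<lambda>i x. - X i x) UNIV"
    by (rule indep_vars_compose2[OF indep]) auto
qed (use bounded K_pos mean variance v_pos in auto)

text \<open>Hoeffding's lemma on the interval from \<open>-K\<close> to \<open>K\<close>, whose
  length \<open>2 * K\<close> turns the factor 1/8 into 1/2. It is applied with a positive
  parameter; negative \<open>\<theta>\<close> is moved to \<open>- X i\<close>.\<close>

lemma exp_moment_X: "expectation (\<lambda>x. exp (\<theta> * X i x)) \<le> exp (\<theta>\<^sup>2 * K\<^sup>2 / 2)"
proof -
  have *: "expectation (\<lambda>x. exp (\<theta> * Y x)) \<le> exp (\<theta>\<^sup>2 * K\<^sup>2 / 2)"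
    if Y: "Y \<in> borel_measurable M" "AE x in M. \<bar>Y x\<bar> \<le> K" "expectation Y = 0" and "\<theta> > 0" for Y \<theta>
  proof -
    interpret interval_bounded_random_variable M Y "-K" K
      by unfold_locales (use Y in \<open>auto elim!: eventually_mono\<close>)
    have "integrable M (\<lambda>x. exp (\<theta> * Y x))"
      by (rule integrable_continuous_bounded[OF Y(1,2)]) (auto intro!: continuous_intros)
    then have "ennreal (expectation (\<lambda>x. exp (\<theta> * Y x))) = (\<integral>\<^sup>+x. exp (\<theta> * Y x) \<partial>M)"
      by (subst nn_integral_eq_integral) auto
    also have "\<dots> \<le> ennreal (exp (\<theta>\<^sup>2 * (K - (-K))\<^sup>2 / 8))"
      by (rule Hoeffdings_lemma_nn_integral_0) (use that in auto)
    also have "\<theta>\<^sup>2 * (K - (-K))\<^sup>2 / 8 = \<theta>\<^sup>2 * K\<^sup>2 / 2"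
      by (simp add: power2_eq_square)
    finally show ?thesis by simp
  qed
  consider "\<theta> > 0" | "\<theta> = 0" | "\<theta> < 0" by linarith
  then show ?thesis
  proof cases
    case 1
    then show ?thesis using *[of "X i" \<theta>] bounded mean by auto
  next
    case 2
    then show ?thesis by (simp add: prob_space)
  next
    case 3
    then show ?thesis using *[of "\<lambda>x. - X i x" "-\<theta>"] bounded mean by auto
  qed
qed

lemma integrable_exp_X: "integrable M (\<lambda>x. exp (\<theta> * X i x))"
  by (rule integrable_continuous_bounded[OF _ bounded]) (auto intro!: continuous_intros)

lemma exp_moment_sum:
  assumes "finite I"
  shows "expectation (\<lambda>x. exp (\<theta> * (\<Sum>i\<in>I. X i x))) \<le> exp (\<theta>\<^sup>2 * K\<^sup>2 * card I / 2)"
proof -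
  have "expectation (\<lambda>x. exp (\<theta> * (\<Sum>i\<in>I. X i x))) = expectation (\<lambda>x. \<Prod>i\<in>I. exp (\<theta> * X i x))"
    using assms by (simp add: sum_distrib_left exp_sum)
  also have "\<dots> = (\<Prod>i\<in>I. expectation (\<lambda>x. exp (\<theta> * X i x)))"
    by (rule indep_vars_lebesgue_integral[OF assms indep_vars_compose2[OF indep_vars_subset[OF indep]]])
      (auto intro: integrable_exp_X)
  also have "\<dots> \<le> (\<Prod>i\<in>I. exp (\<theta>\<^sup>2 * K\<^sup>2 / 2))"
    by (intro prod_mono) (auto intro: exp_moment_X)
  also have "\<dots> = exp (\<theta>\<^sup>2 * K\<^sup>2 * card I / 2)"
    by (simp flip: exp_of_nat_mult add: algebra_simps)
  finally show ?thesis .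
qed

lemma second_moment_sum:
  assumes "finite I"
  shows "expectation (\<lambda>x. (\<Sum>i\<in>I. X i x)\<^sup>2) = v * card I"
  using assms
proof (induction I)
  case (insert j I)
  have iX: "integrable M (X i)" "integrable M (\<lambda>x. (X i x)\<^sup>2)" for i
    using integrable_continuous_bounded[OF _ bounded continuous_on_id, of i]
      integrable_continuous_bounded[OF _ bounded continuous_on_power[OF continuous_on_id], of i 2]
    by auto
  have iS: "integrable M (\<lambda>x. \<Sum>i\<in>I. X i x)" "integrable M (\<lambda>x. (\<Sum>i\<in>I. X i x)\<^sup>2)"
    using integrable_continuous_bounded[OF _ bounded_sum[OF insert(1)] continuous_on_id]
      integrable_continuous_bounded[OF _ bounded_sum[OF insert(1)]
        continuous_on_power[OF continuous_on_id], of 2]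
    by auto
  have ind: "indep_var borel (X j) borel (\<lambda>x. \<Sum>i\<in>I. X i x)"
    by (rule indep_vars_sum[OF insert(1,2) indep_vars_subset[OF indep]]) auto
  have "expectation (\<lambda>x. (\<Sum>i\<in>insert j I. X i x)\<^sup>2) =
      expectation (\<lambda>x. (X j x)\<^sup>2 + 2 * (X j x * (\<Sum>i\<in>I. X i x)) + (\<Sum>i\<in>I. X i x)\<^sup>2)"
    using insert by (simp add: power2_sum algebra_simps)
  also have "\<dots> = expectation (\<lambda>x. (X j x)\<^sup>2) + 2 * expectation (\<lambda>x. X j x * (\<Sum>i\<in>I. X i x))
      + expectation (\<lambda>x. (\<Sum>i\<in>I. X i x)\<^sup>2)"
    using iX iS indep_var_integrable[OF ind iX(1) iS(1)] by simp
  also have "\<dots> = v + v * card I"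
    using indep_var_lebesgue_integral[OF ind iX(1) iS(1)] insert variance mean by simp
  finally show ?case using insert by (simp add: algebra_simps)
qed simp

text \<open>The constant is 4^4, from x <= exp x at x = |s|/4. It controls the fourth moment of a
  sum by exponential moments, so that no fourth power of a sum has to be expanded.\<close>

lemma fourth_power_le_exp: "(s::real) ^ 4 \<le> 256 * (exp s + exp (- s))"
proof -
  have "(\<bar>s\<bar> / 4) ^ 4 \<le> exp (\<bar>s\<bar> / 4) ^ 4"
    using exp_ge_add_one_self[of "\<bar>s\<bar> / 4"] by (intro power_mono) linarith+
  also have "\<dots> = exp \<bar>s\<bar>" by (simp flip: exp_of_nat_mult)
  also have "\<dots> \<le> exp s + exp (- s)" by (cases "s \<ge> 0") auto
  finally show ?thesis by (simp add: power_divide)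
qed

text \<open>
  The polynomial \<open>p\<close> below is bounded above, at most \<open>\<eta>\<close> on \<open>{..\<gamma>}\<close>, and has expectation larger than \<open>\<eta>\<close>
  under the normalised sum, whose first moment vanishes and whose second and fourth moments are
  controlled; this bounds the mass of \<open>{\<gamma><..}\<close> from below.
\<close>

lemma one_sided_lower_bound:
  "\<exists>\<gamma>>0. \<exists>\<delta>>0. \<forall>I. finite I \<longrightarrow> I \<noteq> {} \<longrightarrow>
     \<delta> \<le> prob {x \<in> space M. (\<Sum>i\<in>I. X i x) > \<gamma> * sqrt (card I)}"
proof -
  \<comment> \<open>\<open>B\<close> bounds the fourth moment (256 times two exponential moments),
    and \<open>\<kappa>\<close> makes \<open>\<kappa> * B = v / 4\<close>. With
    \<open>\<alpha>\<close> one has \<open>\<kappa> * \<alpha> \<ge> 1\<close>, so for negative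
    arguments the square is beaten by the linear term up to \<open>\<alpha>\<close> and by the
    quartic term beyond. \<open>\<gamma>\<close> ensures
    \<open>(\<alpha> + 1) * \<gamma> \<le> \<eta>\<close>, and \<open>m\<close> is the global upper
    bound of \<open>p\<close>.\<close>
  define B where "B = 512 * exp (K\<^sup>2 / 2)"
  define \<kappa> where "\<kappa> = v / (4 * B)"
  define \<alpha> where "\<alpha> = 1 + 1 / \<kappa>"
  define \<eta> where "\<eta> = v / 4"
  define \<gamma> where "\<gamma> = min 1 (\<eta> / (\<alpha> + 1))"
  define m where "m = \<alpha>\<^sup>2 / 2 + 1 / \<kappa>"
  define p where "p s = \<alpha> * s + s\<^sup>2 - \<kappa> * s ^ 4" for s :: real
  have "B > 0" by (simp add: B_def)
  with v_pos have "\<kappa> > 0" "\<eta> > 0" by (auto simp: \<kappa>_def \<eta>_def)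
  then have "\<alpha> > 1" "m > 0" by (auto simp: \<alpha>_def m_def intro!: add_nonneg_pos)
  with \<open>\<eta> > 0\<close> have "\<gamma> > 0" by (simp add: \<gamma>_def)
  note pos = \<open>B > 0\<close> \<open>\<kappa> > 0\<close> \<open>\<alpha> > 1\<close> \<open>\<eta> > 0\<close> \<open>\<gamma> > 0\<close> \<open>m > 0\<close>
  have p_small: "p s \<le> \<eta>" if "s \<le> \<gamma>" for s
  proof (cases "s \<ge> 0")
    case True
    have "p s \<le> \<alpha> * s + s * s"
      using pos by (simp add: p_def power2_eq_square)
    also have "\<dots> \<le> \<alpha> * \<gamma> + \<gamma> * 1"
      using True that pos by (intro add_mono mult_mono) (auto simp: \<gamma>_def)
    also have "\<dots> = (\<alpha> + 1) * \<gamma>" by (simp add: algebra_simps)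
    also have "\<dots> \<le> (\<alpha> + 1) * (\<eta> / (\<alpha> + 1))"
      using pos by (intro mult_left_mono) (auto simp: \<gamma>_def)
    also have "\<dots> = \<eta>" using pos by simp
    finally show ?thesis .
  next
    case False
    define x where "x = - s"
    have x: "x > 0" using False by (simp add: x_def)
    have "x\<^sup>2 \<le> \<alpha> * x + \<kappa> * x ^ 4"
    proof (cases "x \<le> \<alpha>")
      case True
      then have "x * x \<le> \<alpha> * x" using x by (intro mult_right_mono) auto
      then show ?thesis using pos x by (simp add: power2_eq_square add_increasing2)
    next
      case False
      have "1 \<le> \<kappa> * (\<alpha> * \<alpha>)"
      proof -
        have "1 \<le> \<kappa> * \<alpha>" using pos(2) by (simp add: \<alpha>_def field_simps)
        then show ?thesis using pos by (smt (verit) mult.assoc mult_le_cancel_left1)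
      qed
      also have "\<dots> \<le> \<kappa> * (x * x)"
        using False pos x by (intro mult_left_mono mult_mono) auto
      finally have "1 * (x * x) \<le> \<kappa> * (x * x) * (x * x)"
        by (rule mult_right_mono) auto
      then show ?thesis using pos x by (simp add: power2_eq_square power4_eq_xxxx mult.assoc add_increasing)
    qed
    then have "p s \<le> 0" by (simp add: p_def x_def)
    then show ?thesis using pos by simp
  qed
  have p_le: "p s \<le> m" for s
  proof -
    have "\<alpha> * s \<le> (\<alpha>\<^sup>2 + s\<^sup>2) / 2"
      using sum_squares_bound[of \<alpha> s] by simp
    moreover have "3 / 2 * s\<^sup>2 - \<kappa> * s ^ 4 \<le> 1 / \<kappa>"
    proof -
      have "0 \<le> (\<kappa> * s\<^sup>2 - 3 / 4)\<^sup>2" by simp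
      also have "\<dots> = \<kappa>\<^sup>2 * s ^ 4 - 3 / 2 * \<kappa> * s\<^sup>2 + 9 / 16"
        by (simp add: power2_eq_square power4_eq_xxxx algebra_simps)
      finally have "\<kappa> * (3 / 2 * s\<^sup>2 - \<kappa> * s ^ 4) \<le> 1"
        by (simp add: power2_eq_square algebra_simps)
      then show ?thesis using pos by (simp add: field_simps)
    qed
    ultimately show ?thesis by (simp add: p_def m_def field_simps)
  qed
  have "v / (2 * m) \<le> prob {x \<in> space M. (\<Sum>i\<in>I. X i x) > \<gamma> * sqrt (card I)}"
    if I: "finite I" "I \<noteq> {}" for I
  proof -
    define n where "n = sqrt (card I)"
    have n: "n > 0" "n\<^sup>2 = card I" using I by (auto simp: n_def card_gt_0_iff)
    define s where "s x = (\<Sum>i\<in>I. X i x) / n" for x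
    have [measurable]: "s \<in> borel_measurable M" unfolding s_def by measurable
    have "AE x in M. \<bar>s x\<bar> \<le> K * card I / n"
      using bounded_sum[OF I(1)] by eventually_elim (use n in \<open>simp add: s_def divide_right_mono\<close>)
    note int = integrable_continuous_bounded[OF _ this]
    have int_s: "integrable M s" "integrable M (\<lambda>x. (s x)\<^sup>2)" "integrable M (\<lambda>x. (s x) ^ 4)"
      "integrable M (\<lambda>x. exp (s x))" "integrable M (\<lambda>x. exp (- s x))" "integrable M (\<lambda>x. p (s x))"
      unfolding p_def by (rule int, simp, intro continuous_intros)+
    have iX: "integrable M (X i)" for i
      using integrable_continuous_bounded[OF _ bounded continuous_on_id, of i] by auto
    have E1: "expectation s = 0"
      unfolding s_def using iX mean by simp
    have E2: "expectation (\<lambda>x. (s x)\<^sup>2) = v"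
      using second_moment_sum[OF I(1)] n I by (simp add: s_def power_divide)
    have exp1: "expectation (\<lambda>x. exp (\<theta> * s x)) \<le> exp (K\<^sup>2 / 2)" if "\<bar>\<theta>\<bar> = 1" for \<theta>
    proof -
      have "\<theta>\<^sup>2 = 1" using that by (metis one_power2 power2_abs)
      then show ?thesis
        using exp_moment_sum[OF I(1), of "\<theta> / n"] n I by (simp add: s_def power_divide)
    qed
    have "expectation (\<lambda>x. (s x) ^ 4) \<le> expectation (\<lambda>x. 256 * (exp (s x) + exp (- s x)))"
      using int_s by (intro integral_mono fourth_power_le_exp) auto
    also have "\<dots> \<le> B"
      using int_s exp1[of 1] exp1[of "-1"] by (simp add: B_def)
    finally have E4: "expectation (\<lambda>x. (s x) ^ 4) \<le> B" .
    \<comment> \<open>The linear term, which suppresses negative values of the sum, has expectation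
      zero and costs nothing here.\<close>
    have "v - \<kappa> * B \<le> expectation (\<lambda>x. p (s x))"
      using int_s E1 E2 E4 pos by (simp add: p_def)
    also have "\<dots> \<le> expectation (\<lambda>x. \<eta> + m * indicator {x \<in> space M. s x > \<gamma>} x)"
    proof (rule integral_mono)
      fix x assume "x \<in> space M"
      then show "p (s x) \<le> \<eta> + m * indicator {x \<in> space M. s x > \<gamma>} x"
        using p_small[of "s x"] p_le[of "s x"] pos by (auto simp: indicator_def not_less)
        next
      show "integrable M (\<lambda>x. \<eta> + m * indicat_real {x \<in> space M. \<gamma> < s x} x)"
        by (rule integrable_const_bound[where B = "\<eta> + m"]) (use pos in \<open>auto simp: indicator_def\<close>)
    qed (use int_s in auto)
    also have "\<dots> = \<eta> + m * prob {x \<in> space M. s x > \<gamma>}"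
    proof -
      have "{x \<in> space M. s x > \<gamma>} \<in> events" by measurable
      then have "integrable M (\<lambda>x. m * indicat_real {x \<in> space M. s x > \<gamma>} x)"
        "expectation (indicat_real {x \<in> space M. s x > \<gamma>}) = prob {x \<in> space M. s x > \<gamma>}"
        by (auto simp: less_top[symmetric])
      then show ?thesis by (simp add: prob_space)
    qed
    also have "v - \<kappa> * B = \<eta> + v / 2" using pos by (simp add: \<kappa>_def \<eta>_def field_simps)
    finally have "v / (2 * m) \<le> prob {x \<in> space M. s x > \<gamma>}"
      using pos by (simp add: field_simps)
    also have "{x \<in> space M. s x > \<gamma>} = {x \<in> space M. (\<Sum>i\<in>I. X i x) > \<gamma> * sqrt (card I)}"
      using n(1) by (auto simp: s_def n_def field_simps)
    finally show ?thesis .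
  qed
  moreover have "v / (2 * m) > 0" using pos v_pos by simp
  ultimately show ?thesis using pos(5) by blast
qed

end

section \<open>Second Borel-Cantelli lemma and maximal inequalities\<close>

text \<open>The probability of avoiding all events in a window is the product of the 1 - p_k, at
  most exp of minus their sum. The events are expressed through variables with values in varying
  spaces \<open>N k\<close>, because they will be blocks of increments of varying length.\<close>

lemma (in prob_space) borel_cantelli_indep:
  fixes Z :: "nat \<Rightarrow> 'a \<Rightarrow> 'b"
  assumes ind: "indep_vars N Z UNIV" and S: "\<And>k. S k \<in> sets (N k)"
    and ns: "\<not> summable (\<lambda>k. prob {x \<in> space M. Z k x \<in> S k})"
  shows "AE x in M. \<exists>\<^sub>F k in sequentially. Z k x \<in> S k"
proof -
  define p where "p k = prob {x \<in> space M. Z k x \<in> S k}" for k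
  have Zm [measurable]: "Z k \<in> measurable M (N k)" for k
    using ind by (auto simp: indep_vars_def)
  note [measurable] = S
  have p: "0 \<le> p k" "p k \<le> 1" for k by (auto simp: p_def)
  have prod: "prob {x \<in> space M. \<forall>k\<in>{a..<b}. Z k x \<notin> S k} = (\<Prod>k\<in>{a..<b}. 1 - p k)" if "a < b" for a b
  proof -
    have "prob (\<Inter>k\<in>{a..<b}. Z k -` (space (N k) - S k) \<inter> space M)
        = (\<Prod>k\<in>{a..<b}. prob (Z k -` (space (N k) - S k) \<inter> space M))"
      by (rule indep_varsD[OF ind]) (use that in auto)
    also have "(\<Inter>k\<in>{a..<b}. Z k -` (space (N k) - S k) \<inter> space M)
        = {x \<in> space M. \<forall>k\<in>{a..<b}. Z k x \<notin> S k}"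
      using that measurable_space[OF Zm] by auto
    also have "(\<lambda>k. prob (Z k -` (space (N k) - S k) \<inter> space M)) = (\<lambda>k. 1 - p k)"
    proof
      fix k
      have "Z k -` (space (N k) - S k) \<inter> space M = space M - {x \<in> space M. Z k x \<in> S k}"
        using measurable_space[OF Zm] by auto
      then show "prob (Z k -` (space (N k) - S k) \<inter> space M) = 1 - p k"
        by (simp add: prob_compl p_def)
    qed
    finally show ?thesis .
  qed
  have zero: "prob {x \<in> space M. \<forall>k\<ge>a. Z k x \<notin> S k} = 0" for a
  proof (rule ccontr)
    assume "\<not> ?thesis"
    then have q: "prob {x \<in> space M. \<forall>k\<ge>a. Z k x \<notin> S k} > 0" (is "?q > 0")
      by (simp add: zero_less_measure_iff)
    \<comment> \<open>A positive probability of avoiding all events from \<open>a\<close> on would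
      bound every partial sum by minus its logarithm.\<close>
    have bnd: "(\<Sum>k\<in>{a..<b}. p k) \<le> - ln ?q" for b
    proof (cases "a < b")
      case True
      have "?q \<le> prob {x \<in> space M. \<forall>k\<in>{a..<b}. Z k x \<notin> S k}"
        by (rule finite_measure_mono) auto
      also have "\<dots> = (\<Prod>k\<in>{a..<b}. 1 - p k)" by (rule prod[OF True])
      also have "\<dots> \<le> (\<Prod>k\<in>{a..<b}. exp (- p k))"
        using p by (intro prod_mono) (auto simp: exp_ge_add_one_self[of "- p _", simplified])
      also have "\<dots> = exp (- (\<Sum>k\<in>{a..<b}. p k))" by (simp add: exp_sum flip: sum_negf)
      finally have "ln ?q \<le> ln (exp (- (\<Sum>k\<in>{a..<b}. p k)))"
        using q by (subst ln_le_cancel_iff) auto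
      then show ?thesis by simp
    next
      case False
      then show ?thesis using q by (simp add: ln_le_zero_iff)
    qed
    have "summable (\<lambda>k. p (k + a))"
    proof (rule bounded_imp_summable[where B = "- ln ?q"])
      fix n
      have "(\<Sum>k\<le>n. p (k + a)) = (\<Sum>k\<in>{a..<Suc n + a}. p k)"
        by (rule sum.reindex_bij_witness[of _ "\<lambda>k. k - a" "\<lambda>k. k + a"]) auto
      then show "(\<Sum>k\<le>n. p (k + a)) \<le> - ln ?q" using bnd[of "Suc n + a"] by simp
    qed (use p in auto)
    then have "summable p" by (simp only: summable_iff_shift)
    then show False using ns by (simp add: p_def[abs_def])
  qed
  have "AE x in M. \<forall>a. \<exists>k\<ge>a. Z k x \<in> S k"
    unfolding AE_all_countable
  proof
    fix a
    show "AE x in M. \<exists>k\<ge>a. Z k x \<in> S k"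
      using zero[of a] prob_eq_0[of "{x \<in> space M. \<forall>k\<ge>a. Z k x \<notin> S k}"]
      by (auto elim!: AE_mp)
  qed
  then show ?thesis by (simp add: frequently_sequentially)
qed

text \<open>
  Freezing the walk once it reaches level \<open>l\<close> turns a maximal inequality into an exponential Markov
  inequality at the single time \<open>n\<close>.
\<close>

primrec stopped_sum :: "real \<Rightarrow> nat \<Rightarrow> (nat \<Rightarrow> real) \<Rightarrow> real" where
  "stopped_sum l 0 y = 0"
| "stopped_sum l (Suc n) y = stopped_sum l n y + (if stopped_sum l n y < l then y n else 0)"

lemma stopped_sum_restrict: "n \<le> m \<Longrightarrow> stopped_sum l n (restrict y {..<m}) = stopped_sum l n y"
  by (induction n) auto

lemma stopped_sum_measurable [measurable]:
  "n \<le> m \<Longrightarrow> stopped_sum l n \<in> borel_measurable (\<Pi>\<^sub>M i\<in>{..<m}. borel)"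
proof (induction n)
  case (Suc n)
  then have [measurable]: "stopped_sum l n \<in> borel_measurable (\<Pi>\<^sub>M i\<in>{..<m}. borel)"
    and [measurable]: "(\<lambda>y. y n) \<in> borel_measurable (\<Pi>\<^sub>M i\<in>{..<m}. borel :: real measure)" by auto
  have "(\<lambda>y. stopped_sum l n y + (if stopped_sum l n y < l then y n else 0))
      \<in> borel_measurable (\<Pi>\<^sub>M i\<in>{..<m}. borel)" by measurable
  then show ?case by simp
next
  case 0
  have "(\<lambda>y. 0) \<in> borel_measurable (\<Pi>\<^sub>M i\<in>{..<m}. borel :: real measure)" by measurable
  then show ?case by (simp add: stopped_sum.simps(1)[abs_def])
qed

lemma stopped_sum_cases:
  "0 < l \<Longrightarrow> l \<le> stopped_sum l n y \<or>
     (stopped_sum l n y = (\<Sum>i<n. y i) \<and> (\<forall>k\<le>n. (\<Sum>i<k. y i) < l))"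
  by (induction n) (auto simp: le_Suc_eq)

context centred_walk
begin

lemma stopped_sum_indep:
  "indep_var borel (X n) borel (\<lambda>x. stopped_sum l n (\<lambda>i. X i x))"
proof -
  have "indep_var borel ((\<lambda>f. f n) \<circ> (\<lambda>x. restrict (\<lambda>i. X i x) {n}))
      borel (stopped_sum l n \<circ> (\<lambda>x. restrict (\<lambda>i. X i x) {..<n}))"
    by (rule indep_var_compose[OF indep_var_restrict[OF indep]]) auto
  then show ?thesis by (simp add: comp_def stopped_sum_restrict)
qed

lemma stopped_sum_bounded: "AE x in M. \<bar>stopped_sum l n (\<lambda>i. X i x)\<bar> \<le> n * K"
proof (induction n)
  case (Suc n)
  then show ?case using bounded[of n]
    by eventually_elim (auto simp: algebra_simps)
qed simp

lemma measurable_stopped_sum_X [measurable]: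
  "(\<lambda>x. stopped_sum l n (\<lambda>i. X i x)) \<in> borel_measurable M"
  by (induction n) auto

text \<open>Below the level the next increment is independent of the past and costs at most the
  factor \<open>c\<close>; at or above the level nothing is added, and the factor 1 is at most
  \<open>c\<close>. Freezing thus preserves the bound for free sums.\<close>

lemma exp_moment_stopped_sum:
  "expectation (\<lambda>x. exp (\<theta> * stopped_sum l n (\<lambda>i. X i x))) \<le> exp (\<theta>\<^sup>2 * K\<^sup>2 * n / 2)"
proof (induction n)
  case (Suc n)
  define c where "c = exp (\<theta>\<^sup>2 * K\<^sup>2 / 2)"
  define T where "T = (\<lambda>x. stopped_sum l n (\<lambda>i. X i x))"
  define g where "g t = exp (\<theta> * t) * indicator {..<l} t" for t
  define h where "h t = exp (\<theta> * t) * indicator {l..} t" for t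
  have [measurable]: "g \<in> borel_measurable borel" "h \<in> borel_measurable borel"
    unfolding g_def h_def by measurable
  have [measurable]: "T \<in> borel_measurable M" by (simp add: T_def)
  have iT: "integrable M (\<lambda>x. exp (\<theta> * T x))"
    unfolding T_def by (rule integrable_continuous_bounded[OF _ stopped_sum_bounded]) (auto intro!: continuous_intros)
  have ig: "integrable M (\<lambda>x. g (T x))" "integrable M (\<lambda>x. h (T x))"
    by (rule Bochner_Integration.integrable_bound[OF iT]; auto simp: g_def h_def indicator_def)+
  have ind: "indep_var borel (\<lambda>x. exp (\<theta> * X n x)) borel (\<lambda>x. g (T x))"
    using indep_var_compose[OF stopped_sum_indep[of n l], of "\<lambda>x. exp (\<theta> * x)" borel g borel]
    by (simp add: comp_def T_def)
  note ip = indep_var_integrable[OF ind integrable_exp_X ig(1)]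
  have "expectation (\<lambda>x. exp (\<theta> * stopped_sum l (Suc n) (\<lambda>i. X i x)))
      = expectation (\<lambda>x. exp (\<theta> * X n x) * g (T x) + h (T x))"
    by (intro Bochner_Integration.integral_cong) (auto simp: T_def g_def h_def algebra_simps exp_add)
  also have "\<dots> = expectation (\<lambda>x. exp (\<theta> * X n x)) * expectation (\<lambda>x. g (T x)) + expectation (\<lambda>x. h (T x))"
    using ip ig indep_var_lebesgue_integral[OF ind integrable_exp_X ig(1)] by simp
  also have "\<dots> \<le> c * expectation (\<lambda>x. g (T x)) + c * expectation (\<lambda>x. h (T x))"
  proof (intro add_mono mult_right_mono)
    have "1 * expectation (\<lambda>x. h (T x)) \<le> c * expectation (\<lambda>x. h (T x))"
      by (intro mult_right_mono) (auto simp: c_def h_def)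
    then show "expectation (\<lambda>x. h (T x)) \<le> c * expectation (\<lambda>x. h (T x))" by simp
  qed (auto simp: c_def g_def exp_moment_X)
  also have "\<dots> = c * expectation (\<lambda>x. g (T x) + h (T x))"
    using ig by (simp add: algebra_simps)
  also have "(\<lambda>x. g (T x) + h (T x)) = (\<lambda>x. exp (\<theta> * T x))"
    by (auto simp: g_def h_def fun_eq_iff indicator_def)
  also have "c * expectation (\<lambda>x. exp (\<theta> * T x)) \<le> c * exp (\<theta>\<^sup>2 * K\<^sup>2 * n / 2)"
    using Suc by (intro mult_left_mono) (auto simp: T_def c_def)
  also have "\<dots> = exp (\<theta>\<^sup>2 * K\<^sup>2 * Suc n / 2)"
    by (simp add: c_def field_simps flip: exp_add)
  finally show ?case .
qed (simp add: prob_space)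

lemma max_tail_one_sided:
  assumes "l > 0" "n > 0"
  shows "prob {x \<in> space M. \<exists>k\<le>n. (\<Sum>i<k. X i x) \<ge> l} \<le> exp (- l\<^sup>2 / (2 * K\<^sup>2 * n))"
proof -
  \<comment> \<open>The minimiser of the exponent
    \<open>\<theta>\<^sup>2 * K\<^sup>2 * n / 2 - \<theta> * l\<close>.\<close>
  define \<theta> where "\<theta> = l / (n * K\<^sup>2)"
  define T where "T = (\<lambda>x. stopped_sum l n (\<lambda>i. X i x))"
  have \<theta>: "\<theta> > 0" using assms K_pos by (simp add: \<theta>_def)
  have [measurable]: "T \<in> borel_measurable M" by (simp add: T_def)
  have iT: "integrable M (\<lambda>x. exp (\<theta> * T x))"
    unfolding T_def by (rule integrable_continuous_bounded[OF _ stopped_sum_bounded]) (auto intro!: continuous_intros)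
  have "prob {x \<in> space M. \<exists>k\<le>n. (\<Sum>i<k. X i x) \<ge> l} \<le> prob {x \<in> space M. exp (\<theta> * T x) \<ge> exp (\<theta> * l)}"
  proof (rule finite_measure_mono)
    show "{x \<in> space M. \<exists>k\<le>n. (\<Sum>i<k. X i x) \<ge> l} \<subseteq> {x \<in> space M. exp (\<theta> * T x) \<ge> exp (\<theta> * l)}"
      using \<theta> assms stopped_sum_cases[of l n] by (auto simp: T_def) (meson not_less)
  qed measurable
  also have "\<dots> \<le> expectation (\<lambda>x. exp (\<theta> * T x)) / exp (\<theta> * l)"
    by (rule integral_Markov_inequality_measure[OF iT, of "{}"]) auto
  also have "\<dots> \<le> exp (\<theta>\<^sup>2 * K\<^sup>2 * n / 2) / exp (\<theta> * l)"
    unfolding T_def by (intro divide_right_mono exp_moment_stopped_sum) auto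
  also have "\<dots> = exp (\<theta>\<^sup>2 * K\<^sup>2 * n / 2 - \<theta> * l)" by (simp add: exp_diff)
  also have "\<theta>\<^sup>2 * K\<^sup>2 * n / 2 - \<theta> * l = - l\<^sup>2 / (2 * K\<^sup>2 * n)"
    using assms K_pos by (simp add: \<theta>_def power2_eq_square field_simps)
  finally show ?thesis .
qed

lemma max_tail:
  assumes "l > 0" "n > 0"
  shows "prob {x \<in> space M. \<exists>k\<le>n. \<bar>\<Sum>i<k. X i x\<bar> \<ge> l} \<le> 2 * exp (- l\<^sup>2 / (2 * K\<^sup>2 * n))"
proof -
  interpret neg: centred_walk M "\<lambda>i x. - X i x" K v by (rule uminus_walk)
  have "prob {x \<in> space M. \<exists>k\<le>n. \<bar>\<Sum>i<k. X i x\<bar> \<ge> l}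
      \<le> prob ({x \<in> space M. \<exists>k\<le>n. (\<Sum>i<k. X i x) \<ge> l} \<union> {x \<in> space M. \<exists>k\<le>n. (\<Sum>i<k. - X i x) \<ge> l})"
  proof (rule finite_measure_mono)
    show "{x \<in> space M. \<exists>k\<le>n. \<bar>\<Sum>i<k. X i x\<bar> \<ge> l} \<subseteq> {x \<in> space M. \<exists>k\<le>n. (\<Sum>i<k. X i x) \<ge> l}
        \<union> {x \<in> space M. \<exists>k\<le>n. (\<Sum>i<k. - X i x) \<ge> l}"
      by (auto simp: sum_negf abs_if split: if_splits)
  qed measurable
  also have "\<dots> \<le> prob {x \<in> space M. \<exists>k\<le>n. (\<Sum>i<k. X i x) \<ge> l} + prob {x \<in> space M. \<exists>k\<le>n. (\<Sum>i<k. - X i x) \<ge> l}"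
    by (rule measure_Un_le) measurable
  also have "\<dots> \<le> 2 * exp (- l\<^sup>2 / (2 * K\<^sup>2 * n))"
    using max_tail_one_sided[OF assms] neg.max_tail_one_sided[OF assms] by simp
  finally show ?thesis .
qed


section \<open>The law of the iterated logarithm up to constants\<close>

text \<open>One maximal inequality per dyadic scale \<open>j\<close> covers every time up to
  2^(j+1), and its failure probabilities are summable. All \<open>k \<le> n\<close> are controlled
  together because the word length depends on the range of the walk and not only on its
  endpoint.\<close>

lemma iterated_log_upper:
  "AE x in M. \<forall>\<^sub>F n in sequentially. \<forall>k\<le>n. \<bar>\<Sum>i<k. X i x\<bar> \<le> 4 * K * sqrt (n * ln (ln n))"
proof -
  \<comment> \<open>The factor \<open>2 * K\<close> makes the exponent in \<open>max_tail\<close>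
    equal to minus \<open>2 * ln j\<close>, hence the tail \<open>2 / j\<^sup>2\<close>.\<close>
  define \<Lambda> where "\<Lambda> j = 2 * K * sqrt (2 ^ Suc j * ln j)" for j :: nat
  define A where "A j = {x \<in> space M. \<exists>k\<le>2 ^ Suc j. \<bar>\<Sum>i<k. X i x\<bar> \<ge> \<Lambda> j}" for j
  have pA: "prob (A j) \<le> 2 * (1 / real j ^ 2)" if "j \<ge> 2" for j
  proof -
    have ln: "ln j > 0" using that by simp
    have "prob (A j) \<le> 2 * exp (- (\<Lambda> j)\<^sup>2 / (2 * K\<^sup>2 * (2 ^ Suc j :: nat)))"
      unfolding A_def by (rule max_tail) (use ln K_pos in \<open>auto simp: \<Lambda>_def\<close>)
    also have "- (\<Lambda> j)\<^sup>2 / (2 * K\<^sup>2 * (2 ^ Suc j :: nat)) = - (2 * ln j)"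
      using ln K_pos by (simp add: \<Lambda>_def power_mult_distrib)
    also have "exp (- (2 * ln j)) = 1 / real j ^ 2"
      using that by (simp add: exp_minus exp_double inverse_eq_divide)
    finally show ?thesis .
  qed
  have "summable (\<lambda>j. 2 * (1 / real j ^ 2))"
    using inverse_power_summable[of 2, where 'a = real] by (intro summable_mult) (simp add: inverse_eq_divide)
  then have "summable (\<lambda>j. prob (A j))"
    by (rule summable_comparison_test'[where N = 2]) (use pA in auto)
  moreover have "A j \<in> events" for j
    unfolding A_def by measurable
  ultimately have "AE x in M. \<forall>\<^sub>F j in sequentially. x \<in> space M - A j"
    by (intro borel_cantelli_AE1) (auto simp: less_top[symmetric])
  then show ?thesis
  proof eventually_elim
    case (elim x)
    then obtain J where J: "\<And>j. j \<ge> J \<Longrightarrow> x \<in> space M - A j"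
      by (auto simp: eventually_sequentially)
    \<comment> \<open>From \<open>j \<ge> 4\<close> on, the square root of \<open>j\<close> is at
      most \<open>j / 2\<close>, hence at most \<open>ln n\<close>; this gives
      \<open>ln j \<le> 2 * ln (ln n)\<close>.\<close>
    define J' where "J' = max J 4"
    have "\<bar>\<Sum>i<k. X i x\<bar> \<le> 4 * K * sqrt (n * ln (ln n))" if n: "n \<ge> 2 ^ J'" and k: "k \<le> n" for n k :: nat
    proof -
      obtain j where j: "2 ^ j \<le> n" "n < 2 ^ Suc j"
      proof -
        have "(1::nat) \<le> 2 ^ J'" by simp
        then have "1 \<le> n" using n by linarith
        then show ?thesis using ex_power_ivl1[of 2 n] that by auto
      qed
      have "J' < Suc j"
        by (rule power_less_imp_less_exp[OF _ order_le_less_trans[OF n j(2)]]) simp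
      then have j4: "j \<ge> 4" "j \<ge> J" by (auto simp: J'_def)
      have "k \<le> 2 ^ Suc j" using k j by simp
      then have "\<bar>\<Sum>i<k. X i x\<bar> < \<Lambda> j"
        using J[OF j4(2)] by (simp add: A_def del: power_Suc) (meson not_le)
      also have "\<Lambda> j \<le> 2 * K * sqrt (4 * (n * ln (ln n)))"
      proof -
        have rn: "2 ^ j \<le> real n" using j(1) by (metis of_nat_le_iff of_nat_numeral of_nat_power)
        moreover from this have "0 < real n" using zero_less_power[of "2::real" j] by linarith
        ultimately have "ln (2 ^ j) \<le> ln n" by (subst ln_le_cancel_iff) auto
        moreover have "real j * (1 / 2) \<le> real j * ln 2"
          using ln2_ge_two_thirds by (intro mult_left_mono) auto
        ultimately have lnn: "real j / 2 \<le> ln n"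
          by (simp add: ln_realpow)
        have "sqrt (real j) \<le> real j / 2"
          using j4 by (intro real_le_lsqrt) (auto simp: power2_eq_square)
        then have "ln (sqrt (real j)) \<le> ln (ln n)"
          using j4 lnn by (subst ln_le_cancel_iff) auto
        then have "ln j \<le> 2 * ln (ln n)"
          using j4 by (simp add: ln_sqrt)
        moreover have "2 ^ Suc j \<le> 2 * real n" using rn by simp
        ultimately have "2 ^ Suc j * ln j \<le> (2 * real n) * (2 * ln (ln n))"
          using j4 by (intro mult_mono) auto
        then show ?thesis using K_pos by (simp add: \<Lambda>_def)
      qed
      also have "\<dots> = 4 * K * sqrt (n * ln (ln n))" by (simp add: real_sqrt_mult)
      finally show ?thesis by simp
    qed
    then show ?case unfolding eventually_sequentially by blast
  qed
qed

text \<open>Sums over disjoint blocks are independent, so their probabilities multiply; the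
  hypothesis is uniform over all finite nonempty index sets and applies to each block.\<close>

lemma many_blocks_lower_bound:
  fixes B :: "nat \<Rightarrow> nat set"
  assumes \<delta>: "\<And>I. finite I \<Longrightarrow> I \<noteq> {} \<Longrightarrow> \<delta> \<le> prob {x \<in> space M. (\<Sum>i\<in>I. X i x) > \<gamma> * sqrt (card I)}"
    and "\<delta> \<ge> 0" and B: "\<And>j. j < m \<Longrightarrow> finite (B j) \<and> B j \<noteq> {}" "disjoint_family_on B {..<m}"
  shows "\<delta> ^ m \<le> prob {x \<in> space M. \<forall>j<m. (\<Sum>i\<in>B j. X i x) > \<gamma> * sqrt (card (B j))}"
proof (cases "m = 0")
  case False
  have "indep_vars (\<lambda>j. PiM (B j) (\<lambda>_. borel)) (\<lambda>j x. restrict (\<lambda>i. X i x) (B j)) {..<m}"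
    by (rule indep_vars_restrict[OF indep]) (use B in auto)
  then have "indep_vars (\<lambda>j. borel) (\<lambda>j x. (\<lambda>f. \<Sum>i\<in>B j. f i) (restrict (\<lambda>i. X i x) (B j))) {..<m}"
    by (rule indep_vars_compose2) auto
  then have ind: "indep_vars (\<lambda>j. borel) (\<lambda>j x. \<Sum>i\<in>B j. X i x) {..<m}"
    by simp
  have "\<delta> ^ m = (\<Prod>j<m. \<delta>)" by simp
  also have "\<dots> \<le> (\<Prod>j<m. prob ((\<lambda>x. \<Sum>i\<in>B j. X i x) -` {\<gamma> * sqrt (card (B j))<..} \<inter> space M))"
  proof (intro prod_mono conjI)
    fix j assume "j \<in> {..<m}"
    then have "\<delta> \<le> prob {x \<in> space M. (\<Sum>i\<in>B j. X i x) > \<gamma> * sqrt (card (B j))}"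
      using B by (intro \<delta>) auto
    also have "{x \<in> space M. (\<Sum>i\<in>B j. X i x) > \<gamma> * sqrt (card (B j))}
        = (\<lambda>x. \<Sum>i\<in>B j. X i x) -` {\<gamma> * sqrt (card (B j))<..} \<inter> space M" by auto
    finally show "\<delta> \<le> prob ((\<lambda>x. \<Sum>i\<in>B j. X i x) -` {\<gamma> * sqrt (card (B j))<..} \<inter> space M)" .
  qed (use assms in auto)
  also have "\<dots> = prob (\<Inter>j\<in>{..<m}. (\<lambda>x. \<Sum>i\<in>B j. X i x) -` {\<gamma> * sqrt (card (B j))<..} \<inter> space M)"
    by (rule indep_varsD_finite[OF ind, symmetric]) (use False in auto)
  also have "(\<Inter>j\<in>{..<m}. (\<lambda>x. \<Sum>i\<in>B j. X i x) -` {\<gamma> * sqrt (card (B j))<..} \<inter> space M)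
      = {x \<in> space M. \<forall>j<m. (\<Sum>i\<in>B j. X i x) > \<gamma> * sqrt (card (B j))}"
    using False by auto
  finally show ?thesis .
qed (simp add: prob_space)

text \<open>
  Cut the first part of \<open>{2\<^sup>k..<2\<^sup>k\<^sup>+\<^sup>1}\<close> into \<open>m\<^sub>k \<approx> ln k / D\<close> blocks of equal length \<open>l\<^sub>k\<close>. With probability at
  least \<open>\<delta>\<close> to the power \<open>m\<^sub>k\<close>, hence at least \<open>1/k\<close>, every block contributes \<open>\<gamma> \<surd>l\<^sub>k\<close> or more, and the harmonic
  series diverges. The walk is then large at one of the two ends of the union of the blocks.
\<close>

lemma iterated_log_lower:
  "\<exists>c>0. AE x in M. \<exists>\<^sub>F n in sequentially. \<bar>\<Sum>i<n. X i x\<bar> \<ge> c * sqrt (n * ln (ln n))"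
proof -
  obtain \<gamma> \<delta> where \<gamma>: "\<gamma> > 0" and \<delta>: "\<delta> > 0"
    and lower: "\<And>I. finite I \<Longrightarrow> I \<noteq> {} \<Longrightarrow> \<delta> \<le> prob {x \<in> space M. (\<Sum>i\<in>I. X i x) > \<gamma> * sqrt (card I)}"
    using one_sided_lower_bound by blast
  \<comment> \<open>Since \<open>exp (- D) \<le> \<delta>\<close>, at most \<open>ln k / D\<close>
    blocks keep the power of \<open>\<delta>\<close> above \<open>1 / k\<close>;
    \<open>D \<ge> 1\<close> guarantees \<open>m k \<le> k\<close>.\<close>
  define D where "D = max 1 (- ln \<delta>)"
  have D: "D \<ge> 1" by (simp add: D_def)
  have \<delta>_ge: "exp (- D) \<le> \<delta>"
  proof -
    have "exp (- D) \<le> exp (ln \<delta>)" by (simp add: D_def)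
    then show ?thesis using \<delta> by simp
  qed
  define m where "m k = nat \<lfloor>ln (real k) / D\<rfloor>" for k
  define l where "l k = 2 ^ k div m k" for k
  define B where "B k j = {2 ^ k + j * l k ..< 2 ^ k + Suc j * l k}" for k j
  \<comment> \<open>The increments of one dyadic window. Windows are disjoint, so the
    \<open>Z k\<close> are independent, and the event \<open>S k\<close> looks only at its own
    window.\<close>
  define Z where "Z k x = restrict (\<lambda>i. X i x) {2 ^ k ..< 2 ^ Suc k}" for k x
  define N where "N k = (\<Pi>\<^sub>M i\<in>{2 ^ k ..< (2::nat) ^ Suc k}. borel :: real measure)" for k
  define S :: "nat \<Rightarrow> (nat \<Rightarrow> real) set" where "S k = {f \<in> space (N k). \<forall>j<m k. (\<Sum>i\<in>B k j. f i) > \<gamma> * sqrt (card (B k j))}" for k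
  have m_le: "m k \<le> k" "real (m k) \<le> ln k / D" if "k \<ge> 1" for k
  proof -
    have "ln (real k) \<ge> 0" using that by simp
    then show *: "real (m k) \<le> ln k / D"
      using D by (simp add: m_def)
    also have "\<dots> \<le> ln k / 1" using D \<open>ln (real k) \<ge> 0\<close> by (intro divide_left_mono) auto
    also have "\<dots> \<le> real k" using that ln_le_minus_one[of "real k"] by simp
    finally show "m k \<le> k" by simp
  qed
  have ml: "m k * l k \<le> 2 ^ k" for k by (simp add: l_def)
  have B_sub: "B k j \<subseteq> {2 ^ k ..< 2 ^ Suc k}" if "j < m k" for k j
  proof -
    have "Suc j * l k \<le> m k * l k" using that by (intro mult_right_mono) auto
    then show ?thesis using ml[of k] by (auto simp: B_def)
  qed
  have cardB: "card (B k j) = l k" for k j by (simp add: B_def)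
  \<comment> \<open>Expressed by division, membership determines the block index from
    \<open>i\<close>, which makes the blocks disjoint.\<close>
  have B_mem: "i \<in> B k j \<longleftrightarrow> l k > 0 \<and> 2 ^ k \<le> i \<and> (i - 2 ^ k) div l k = j" for i k j
  proof (cases "l k = 0")
    case False
    have "(i - 2 ^ k) div l k = j \<longleftrightarrow> j * l k \<le> i - 2 ^ k \<and> i - 2 ^ k < Suc j * l k"
      using False div_nat_eqI[of "l k" j "i - 2 ^ k"] times_div_less_eq_dividend[of "l k" "i - 2^k"]
        dividend_less_div_times[of "l k" "i - 2^k"] by (auto simp: mult.commute)
    moreover have "i \<in> B k j \<longleftrightarrow> 2 ^ k \<le> i \<and> j * l k \<le> i - 2 ^ k \<and> i - 2 ^ k < Suc j * l k"
      unfolding B_def atLeastLessThan_iff by linarith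
    ultimately show ?thesis using False by auto
  qed (simp add: B_def)
  have S_sets: "S k \<in> sets (N k)" for k
  proof -
    have "(\<lambda>f. f i) \<in> borel_measurable (N k)" if "i \<in> B k j" "j < m k" for i j
      unfolding N_def by (rule measurable_component_singleton) (use that B_sub in blast)
    then have [measurable]: "(\<lambda>f. \<Sum>i\<in>B k j. f i) \<in> borel_measurable (N k)" if "j < m k" for j
      using that by (intro borel_measurable_sum)
    have "S k = {f \<in> space (N k). \<forall>j\<in>{..<m k}. (\<Sum>i\<in>B k j. f i) > \<gamma> * sqrt (card (B k j))}"
      by (auto simp: S_def)
    also have "\<dots> \<in> sets (N k)" by (rule sets.sets_Collect_finite_All) auto
    finally show ?thesis .
  qed
  have ZS: "Z k x \<in> S k \<longleftrightarrow> (\<forall>j<m k. (\<Sum>i\<in>B k j. X i x) > \<gamma> * sqrt (l k))" for k x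
  proof -
    have "(\<Sum>i\<in>B k j. Z k x i) = (\<Sum>i\<in>B k j. X i x)" if "j < m k" for j
      by (rule sum.cong) (use B_sub[OF that] in \<open>auto simp: Z_def\<close>)
    then show ?thesis by (auto simp: S_def cardB N_def space_PiM Z_def)
  qed
  have prob_ge: "1 / real k \<le> prob {x \<in> space M. Z k x \<in> S k}" if "k \<ge> 1" for k
  proof -
    have "1 / real k = exp (- ln k)" using that by (simp add: exp_minus inverse_eq_divide)
    also have "\<dots> \<le> exp (- (D * m k))"
      using m_le(2)[OF that] D by (simp add: field_simps)
    also have "\<dots> = exp (- D) ^ m k" by (simp flip: exp_of_nat_mult add: mult.commute)
    also have "\<dots> \<le> \<delta> ^ m k" using \<delta>_ge by (intro power_mono) auto
    also have "\<dots> \<le> prob {x \<in> space M. \<forall>j<m k. (\<Sum>i\<in>B k j. X i x) > \<gamma> * sqrt (card (B k j))}"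
    proof (rule many_blocks_lower_bound[OF lower])
      fix j assume j: "j < m k"
      have "m k \<le> 2 ^ k" using m_le(1)[OF that] by (meson le_trans less_exp less_imp_le)
      then have "l k > 0" using j by (auto simp: l_def div_greater_zero_iff)
      then show "finite (B k j) \<and> B k j \<noteq> {}" by (auto simp: B_def)
    qed (use \<delta> in \<open>auto simp: disjoint_family_on_def B_mem\<close>)
    finally show ?thesis by (simp add: ZS cardB)
  qed
  have infinitely_often: "AE x in M. \<exists>\<^sub>F k in sequentially. Z k x \<in> S k"
  proof (rule borel_cantelli_indep[OF _ S_sets])
    have disj: "disjoint_family (\<lambda>k::nat. {2 ^ k ..< 2 ^ Suc k} :: nat set)"
    proof -
      have "{2 ^ a ..< 2 ^ Suc a} \<inter> {2 ^ b ..< 2 ^ Suc b} = ({} :: nat set)" if "a < b" for a b :: nat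
      proof -
        have "(2::nat) ^ Suc a \<le> 2 ^ b" using that by (intro power_increasing) auto
        then show ?thesis by auto
      qed
      then show ?thesis unfolding disjoint_family_on_def by (metis Int_commute linorder_neqE_nat)
    qed
    show "indep_vars N Z UNIV"
      unfolding N_def[abs_def] Z_def[abs_def]
      by (rule indep_vars_restrict[OF indep _ disj]) auto
    show "\<not> summable (\<lambda>k. prob {x \<in> space M. Z k x \<in> S k})"
    proof
      assume "summable (\<lambda>k. prob {x \<in> space M. Z k x \<in> S k})"
      then have "summable (\<lambda>k. 1 / real k)"
        by (rule summable_comparison_test'[where N = 1]) (use prob_ge in auto)
      then show False using not_summable_harmonic[where 'a = real] by (simp add: inverse_eq_divide)
    qed
  qed
  \<comment> \<open>The 2 is lost because only half of the increment is guaranteed at one of the two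
    ends. The \<open>8 * D\<close> collects \<open>n \<le> 2 ^ Suc k\<close>,
    \<open>m k \<ge> ln k / (2 * D)\<close> and \<open>l k \<ge> 2 ^ k / (2 * m k)\<close>.\<close>
  define c where "c = \<gamma> / (2 * sqrt (8 * D))"
  have large: "\<exists>n\<ge>a. c * sqrt (n * ln (ln n)) \<le> \<bar>\<Sum>i<n. X i x\<bar>"
    if x: "\<And>K. \<exists>k\<ge>K. Z k x \<in> S k" for x and a :: nat
  proof -
    obtain k0 where "exp D \<le> real k0" using real_arch_simple by blast
    obtain k where k: "k \<ge> max (max a 3) k0" and ZSk: "Z k x \<in> S k" using x by blast
    have lnk: "D \<le> ln k"
    proof -
      have "exp D \<le> real k" using \<open>exp D \<le> real k0\<close> k by simp
      then have "ln (exp D) \<le> ln (real k)" using k by (subst ln_le_cancel_iff) auto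
      then show ?thesis by simp
    qed
    have half_floor: "r / 2 \<le> real_of_int \<lfloor>r\<rfloor>" if "r \<ge> 1" for r :: real
    proof -
      have "1 \<le> \<lfloor>r\<rfloor>" using that by (simp add: le_floor_iff)
      then show ?thesis using real_of_int_floor_add_one_gt[of r] by linarith
    qed
    have "1 \<le> ln k / D" using lnk D by simp
    from half_floor[OF this] have mk: "ln k / (2 * D) \<le> m k"
      using \<open>1 \<le> ln k / D\<close> by (simp add: m_def)
    moreover have "0 < ln k / (2 * D)" using lnk D by (intro divide_pos_pos) auto
    ultimately have mk0: "m k > 0" by (cases "m k") auto
    have m2: "m k \<le> 2 ^ k" using m_le(1)[of k] k by (meson le_trans less_exp less_imp_le max.boundedE one_le_numeral)
    have "real (2 ^ k div m k) = real_of_int \<lfloor>real (2 ^ k) / real (m k)\<rfloor>"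
      by (simp only: floor_divide_of_nat_eq of_int_of_nat_eq)
    moreover have "real (2 ^ k) / real (m k) \<ge> 1"
    proof -
      have "real (m k) \<le> real (2 ^ k)" using m2 by (simp only: of_nat_le_iff)
      then show ?thesis using mk0 by (simp add: le_divide_eq)
    qed
    ultimately have lk: "2 ^ k / (2 * real (m k)) \<le> l k"
      using half_floor[of "real (2 ^ k) / real (m k)"] by (simp add: l_def)
    define n0 n1 where "n0 = (2::nat) ^ k" and "n1 = 2 ^ k + m k * l k"
    have diff: "m k * (\<gamma> * sqrt (l k)) \<le> (\<Sum>i<n1. X i x) - (\<Sum>i<n0. X i x)"
    proof -
      have "m k * (\<gamma> * sqrt (l k)) = (\<Sum>j<m k. \<gamma> * sqrt (l k))" by simp
      also have "\<dots> \<le> (\<Sum>j<m k. \<Sum>i\<in>B k j. X i x)"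
        using ZSk by (intro sum_mono) (auto simp: ZS less_imp_le)
      also have "\<dots> = (\<Sum>i\<in>{n0..<n1}. X i x)"
      proof -
        have "(\<Sum>j<m'. \<Sum>i\<in>B k j. X i x) = (\<Sum>i\<in>{2 ^ k..<2 ^ k + m' * l k}. X i x)" for m'
        proof (induction m')
          case (Suc m')
          then show ?case
            by (simp add: B_def sum.atLeastLessThan_concat)
        qed simp
        then show ?thesis by (simp add: n0_def n1_def)
      qed
      also have "\<dots> = (\<Sum>i<n1. X i x) - (\<Sum>i<n0. X i x)"
      proof -
        have "(\<Sum>i<n0. X i x) + (\<Sum>i\<in>{n0..<n1}. X i x) = (\<Sum>i<n1. X i x)"
          unfolding lessThan_atLeast0 by (rule sum.atLeastLessThan_concat) (auto simp: n0_def n1_def)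
        then show ?thesis by simp
      qed
      finally show ?thesis .
    qed
    have bound: "c * sqrt (n * ln (ln n)) \<le> m k * (\<gamma> * sqrt (l k)) / 2" if n: "n \<in> {n0, n1}" for n
    proof -
      have n_le: "2 ^ k \<le> n" "n \<le> 2 ^ Suc k" using n ml[of k] by (auto simp: n0_def n1_def)
      have rn: "real n \<le> 2 ^ Suc k" "2 ^ k \<le> real n"
        using n_le by (metis of_nat_le_iff of_nat_numeral of_nat_power)+
      have "2 ^ 3 \<le> (2::real) ^ k" using k by (intro power_increasing) auto
      then have "8 \<le> (2::real) ^ k" by simp
      then have n8: "8 \<le> real n" using rn(2) by linarith
      have "1 < ln (real n)"
      proof -
        have "exp 1 < real n" using n8 exp_le by linarith
        then have "ln (exp 1) < ln (real n)" using n8 by (subst ln_less_cancel_iff) auto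
        then show ?thesis by simp
      qed
      have "ln (real n) \<le> ln (2 ^ Suc k)" using n8 rn by (subst ln_le_cancel_iff) auto
      also have "\<dots> = Suc k * ln 2" by (simp add: ln_realpow ln_mult algebra_simps)
      \<comment> \<open>This bound on \<open>ln 2\<close> is sharp enough to absorb the successor
        once \<open>k \<ge> 3\<close>, so that \<open>ln n \<le> k\<close>.\<close>
      also have "\<dots> \<le> Suc k * (25 / 36)" using ln2_le_25_over_36 by (intro mult_left_mono) auto
      also have "\<dots> \<le> k" using k by simp
      finally have "ln (ln n) \<le> ln k" using \<open>1 < ln (real n)\<close> by (subst ln_le_cancel_iff) auto
      then have "n * ln (ln n) \<le> 2 ^ Suc k * ln k"
        using rn \<open>1 < ln (real n)\<close> by (intro mult_mono) auto
      also have "\<dots> \<le> 2 ^ Suc k * (2 * D * m k)"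
        using mk D by (intro mult_left_mono) (auto simp: field_simps)
      also have "\<dots> = 8 * D * (real (m k) * real (m k) * (2 ^ k / (2 * real (m k))))"
        using mk0 by (simp add: field_simps)
      also have "\<dots> \<le> 8 * D * (real (m k) * real (m k) * real (l k))"
        by (intro mult_left_mono[OF mult_left_mono[OF lk]]) (use D in auto)
      finally have "sqrt (n * ln (ln n)) \<le> sqrt (8 * D * (real (m k) * real (m k) * real (l k)))" by simp
      also have "\<dots> = sqrt (8 * D) * (m k * sqrt (l k))" by (simp add: real_sqrt_mult)
      finally have "c * sqrt (n * ln (ln n)) \<le> c * (sqrt (8 * D) * (m k * sqrt (l k)))"
        using \<gamma> D by (intro mult_left_mono) (auto simp: c_def)
      also have "\<dots> = m k * (\<gamma> * sqrt (l k)) / 2"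
        using D by (simp add: c_def)
      finally show ?thesis .
    qed
    have "a \<le> k" using k by simp
    also have "k \<le> n0" unfolding n0_def by (intro less_imp_le less_exp)
    finally have "a \<le> n0" .
    moreover have "n0 \<le> n1" by (simp add: n0_def n1_def)
    moreover have "c * sqrt (n0 * ln (ln n0)) \<le> \<bar>\<Sum>i<n0. X i x\<bar> \<or> c * sqrt (n1 * ln (ln n1)) \<le> \<bar>\<Sum>i<n1. X i x\<bar>"
      using diff bound[of n0] bound[of n1] by (simp, linarith)
    ultimately show ?thesis by (meson le_trans)
  qed
  from infinitely_often have "AE x in M. \<exists>\<^sub>F n in sequentially. \<bar>\<Sum>i<n. X i x\<bar> \<ge> c * sqrt (n * ln (ln n))"
  proof eventually_elim
    case (elim x)
    then show ?case using large[of x] unfolding frequently_sequentially by blast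
  qed
  moreover have "c > 0" using \<gamma> D by (simp add: c_def)
  ultimately show ?thesis by blast
qed

end

section \<open>Linear recurrences and carrying\<close>

text \<open>The indeterminate acts on two-sided sequences as the shift. Complex coefficients are
  allowed so that the cofactor in a divisibility relation acts too.\<close>

definition laurent_act :: "(int \<Rightarrow>\<^sub>0 complex) \<Rightarrow> (int \<Rightarrow> complex) \<Rightarrow> int \<Rightarrow> complex" where
  "laurent_act p g k = (\<Sum>i\<in>Poly_Mapping.keys p. Poly_Mapping.lookup p i * g (k + i))"

lemma laurent_act_superset:
  assumes "finite A" "Poly_Mapping.keys p \<subseteq> A"
  shows "laurent_act p g k = (\<Sum>i\<in>A. Poly_Mapping.lookup p i * g (k + i))"
  unfolding laurent_act_def using assms
  by (intro sum.mono_neutral_left) (auto simp: in_keys_iff)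

lemma laurent_act_add: "laurent_act (p + q) g k = laurent_act p g k + laurent_act q g k"
proof -
  have fin: "finite (Poly_Mapping.keys p \<union> Poly_Mapping.keys q)" by simp
  show ?thesis
    using keys_add[of p q]
    by (simp add: laurent_act_superset[OF fin] lookup_add sum.distrib algebra_simps)
qed

lemma laurent_act_single: "laurent_act (Poly_Mapping.single a c) g k = c * g (k + a)"
  by (simp add: laurent_act_def lookup_single)

lemma laurent_act_sum: "laurent_act (\<Sum>a\<in>A. f a) g k = (\<Sum>a\<in>A. laurent_act (f a) g k)"
  by (induction A rule: infinite_finite_induct) (simp_all add: laurent_act_add, simp_all add: laurent_act_def)

lemma poly_mapping_sum_monomials:
  "(p :: int \<Rightarrow>\<^sub>0 complex) = (\<Sum>a\<in>Poly_Mapping.keys p. Poly_Mapping.single a (Poly_Mapping.lookup p a))"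
  by (rule poly_mapping_eqI) (auto simp: lookup_sum lookup_single when_def sum.delta in_keys_iff)

lemma laurent_act_mult: "laurent_act (p * q) g k = laurent_act p (laurent_act q g) k"
proof -
  have single: "laurent_act (Poly_Mapping.single a c * q) g k = c * laurent_act q g (k + a)" for a c
  proof -
    have "Poly_Mapping.single a c * q =
        (\<Sum>b\<in>Poly_Mapping.keys q. Poly_Mapping.single (a + b) (c * Poly_Mapping.lookup q b))"
      by (subst poly_mapping_sum_monomials[of q]) (simp add: sum_distrib_left mult_single)
    then show ?thesis
      by (simp add: laurent_act_sum laurent_act_single laurent_act_def[of q] sum_distrib_left algebra_simps)
  qed
  have "p * q = (\<Sum>a\<in>Poly_Mapping.keys p. Poly_Mapping.single a (Poly_Mapping.lookup p a) * q)"
    by (subst poly_mapping_sum_monomials[of p]) (simp add: sum_distrib_right)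
  then show ?thesis
    by (simp add: laurent_act_sum single laurent_act_def[of p])
qed

lemma laurent_act_dvd_zero:
  assumes "p dvd q" "\<And>k. laurent_act p g k = 0"
  shows "laurent_act q g k = 0"
proof -
  obtain h where "q = h * p" using assms(1) by (auto simp: dvd_def mult.commute)
  moreover have "laurent_act p g = (\<lambda>_. 0)" using assms(2) by auto
  ultimately show ?thesis by (simp add: laurent_act_mult) (simp add: laurent_act_def)
qed

text \<open>The same shift action for ordinary polynomials, which are the entries of the matrix t -
  A; recursion along \<open>pCons\<close> gives the product rule by induction.\<close>

definition poly_act :: "complex poly \<Rightarrow> (int \<Rightarrow> complex) \<Rightarrow> int \<Rightarrow> complex" where
  "poly_act p g k = (\<Sum>i\<le>degree p. poly.coeff p i * g (k + int i))"

lemma poly_act_bound: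
  assumes "degree p \<le> n"
  shows "poly_act p g k = (\<Sum>i\<le>n. poly.coeff p i * g (k + int i))"
  unfolding poly_act_def using assms
  by (intro sum.mono_neutral_left) (auto simp: coeff_eq_0)

lemma laurent_act_of_poly: "laurent_act (laurent_of_poly p) g k = poly_act p g k"
  by (simp add: laurent_of_poly_def laurent_act_sum laurent_act_single poly_act_def)

lemma poly_act_add: "poly_act (p + q) g k = poly_act p g k + poly_act q g k"
proof -
  let ?n = "max (degree p) (degree q)"
  have "degree (p + q) \<le> ?n" by (rule degree_add_le_max)
  then show ?thesis
    by (simp add: poly_act_bound[where n = ?n] sum.distrib algebra_simps)
qed

lemma poly_act_0 [simp]: "poly_act 0 g k = 0"
  by (simp add: poly_act_def)

lemma poly_act_sum: "poly_act (\<Sum>a\<in>A. f a) g k = (\<Sum>a\<in>A. poly_act (f a) g k)"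
  by (induction A rule: infinite_finite_induct) (simp_all add: poly_act_add)

lemma poly_act_smult: "poly_act (Polynomial.smult c p) g k = c * poly_act p g k"
  by (simp add: poly_act_bound[where n = "degree p"] degree_smult_le sum_distrib_left mult.assoc)

lemma poly_act_pCons: "poly_act (pCons a p) g k = a * g k + poly_act p g (k + 1)"
proof -
  have "poly_act (pCons a p) g k = (\<Sum>i\<le>Suc (degree p). poly.coeff (pCons a p) i * g (k + int i))"
    by (rule poly_act_bound) (simp add: degree_pCons_le)
  also have "\<dots> = a * g k + (\<Sum>i\<le>degree p. poly.coeff p i * g (k + 1 + int i))"
    by (subst sum.atMost_Suc_shift) (simp add: algebra_simps)
  finally show ?thesis by (simp add: poly_act_def)
qed

lemma poly_act_mult: "poly_act (p * q) g k = poly_act p (poly_act q g) k"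
  by (induction p arbitrary: k) (simp_all add: poly_act_add poly_act_smult poly_act_pCons)

lemma poly_act_sum_right: "poly_act p (\<lambda>k. \<Sum>a\<in>A. f a k) k = (\<Sum>a\<in>A. poly_act p (f a) k)"
  unfolding poly_act_def by (subst sum.swap) (simp add: sum_distrib_left)

text \<open>
  Cayley--Hamilton for an orbit \<open>g\<close> of \<open>A\<close>: the matrix \<open>t - A\<close> kills \<open>g\<close> when \<open>t\<close> acts as the shift,
  hence so does its product with the adjugate matrix, which is the characteristic polynomial.
\<close>

lemma cayley_hamilton_orbit:
  fixes A :: "complex mat" and g :: "nat \<Rightarrow> int \<Rightarrow> complex"
  assumes A: "A \<in> carrier_mat n n"
    and orbit: "\<And>i k. i < n \<Longrightarrow> g i (k + 1) = (\<Sum>j<n. A $$ (i, j) * g j k)"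
    and i: "i < n"
  shows "poly_act (char_poly A) (g i) k = 0"
proof -
  define C where "C = char_poly_matrix A"
  have C: "C \<in> carrier_mat n n" using A by (simp add: C_def)
  note adj = adj_mat[OF C]
  have row: "(\<Sum>l<n. poly_act (C $$ (j, l)) (g l) k) = 0" if j: "j < n" for j k
  proof -
    have Cjl: "C $$ (j, l) = [: - (A $$ (j, l)), if j = l then 1 else 0 :]" if "l < n" for l
      using A j that by (auto simp: C_def char_poly_matrix_def)
    have "poly_act (C $$ (j, l)) (g l) k = - (A $$ (j, l) * g l k) + (if j = l then g l (k + 1) else 0)"
      if "l < n" for l
      unfolding Cjl[OF that] by (simp add: poly_act_pCons)
    then have "(\<Sum>l<n. poly_act (C $$ (j, l)) (g l) k)
        = (\<Sum>l<n. - (A $$ (j, l) * g l k) + (if j = l then g l (k + 1) else 0))"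
      by (intro sum.cong) auto
    also have "\<dots> = 0"
      using j orbit[OF j, of k] by (simp add: sum_subtractf)
    finally show ?thesis .
  qed
  have "0 = (\<Sum>j<n. poly_act (adj_mat C $$ (i, j)) (\<lambda>k. \<Sum>l<n. poly_act (C $$ (j, l)) (g l) k) k)"
    using row by (simp add: poly_act_def)
  also have "\<dots> = (\<Sum>j<n. \<Sum>l<n. poly_act (adj_mat C $$ (i, j) * C $$ (j, l)) (g l) k)"
    by (simp add: poly_act_sum_right poly_act_mult)
  also have "\<dots> = (\<Sum>l<n. poly_act (\<Sum>j<n. adj_mat C $$ (i, j) * C $$ (j, l)) (g l) k)"
    by (subst sum.swap) (simp add: poly_act_sum)
  also have "\<dots> = (\<Sum>l<n. poly_act (if i = l then char_poly A else 0) (g l) k)"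
  proof (intro sum.cong refl)
    fix l assume l: "l \<in> {..<n}"
    have "(\<Sum>j<n. adj_mat C $$ (i, j) * C $$ (j, l)) = (adj_mat C * C) $$ (i, l)"
      using adj(1) C i l by (simp add: scalar_prod_def lessThan_atLeast0)
    also have "\<dots> = (if i = l then char_poly A else 0)"
      using adj(3) i l by (simp add: char_poly_def C_def)
    finally show "poly_act (\<Sum>j<n. adj_mat C $$ (i, j) * C $$ (j, l)) (g l) k
        = poly_act (if i = l then char_poly A else 0) (g l) k" by simp
  qed
  also have "\<dots> = poly_act (char_poly A) (g i) k"
    using i by (simp add: if_distrib[of "\<lambda>p. poly_act p _ _"] cong: if_cong)
  finally show ?thesis by simp
qed

section \<open>Carrying with a dominant coefficient\<close>

text \<open>With s the sum of the other absolute values, (EDP) reads s < max1 / max2, and this is at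
  most max1 because max2 is a positive integer. A second nonzero coefficient gives s >= 1, hence
  max1 >= 2 by integrality.\<close>

lemma EDP_dominant_coefficient:
  assumes "EDP q"
  obtains j where "j \<in> Poly_Mapping.keys q"
    "(\<Sum>i\<in>Poly_Mapping.keys q - {j}. \<bar>Poly_Mapping.lookup q i\<bar>) < \<bar>Poly_Mapping.lookup q j\<bar>"
    "2 \<le> \<bar>Poly_Mapping.lookup q j\<bar>"
proof -
  define f where "f i = \<bar>Poly_Mapping.lookup q i\<bar>" for i
  define N where "N = image_mset f (mset_set (Poly_Mapping.keys q))"
  define m1 where "m1 = Max_mset N"
  define m2 where "m2 = Max_mset (N - {#m1#})"
  have card: "card (Poly_Mapping.keys q) \<ge> 2"
    and ineq: "real_of_int m1 * (1 + 1 / real_of_int m2) > real_of_int (\<Sum>\<^sub># N)"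
    using assms unfolding EDP_def Let_def m1_def m2_def N_def f_def by auto
  have "N \<noteq> {#}" using card by (auto simp: N_def mset_set_empty_iff)
  then have "m1 \<in># N" by (simp add: m1_def)
  then obtain j where j: "j \<in> Poly_Mapping.keys q" "f j = m1" by (auto simp: N_def)
  have keys: "mset_set (Poly_Mapping.keys q) = {#j#} + mset_set (Poly_Mapping.keys q - {j})"
    using j(1) by (simp add: mset_set.remove)
  have Nj: "N - {#m1#} = image_mset f (mset_set (Poly_Mapping.keys q - {j}))"
    using j(2) by (simp add: N_def keys)
  have ne: "Poly_Mapping.keys q - {j} \<noteq> {}"
  proof
    assume "Poly_Mapping.keys q - {j} = {}"
    then have "Poly_Mapping.keys q \<subseteq> {j}" by auto
    then have "card (Poly_Mapping.keys q) \<le> card {j}" by (intro card_mono) auto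
    then show False using card by simp
  qed
  then have "m2 \<in># N - {#m1#}" unfolding m2_def by (intro Max_in) (auto simp: Nj)
  then obtain i where i: "i \<in> Poly_Mapping.keys q - {j}" "m2 = f i" by (auto simp: Nj)
  have f1: "f i \<ge> 1" if "i \<in> Poly_Mapping.keys q" for i
    using that by (auto simp: f_def in_keys_iff)
  have m2: "m2 \<ge> 1" using i f1 by auto
  define s where "s = (\<Sum>i\<in>Poly_Mapping.keys q - {j}. f i)"
  have "\<Sum>\<^sub># N = m1 + s"
    using j(2) by (simp add: N_def keys s_def sum_unfold_sum_mset)
  moreover have m1: "m1 \<ge> 1" using f1 j by auto
  have "real_of_int m1 / m2 \<le> m1"
    using m1 m2 by (simp add: divide_le_eq mult_le_cancel_left1)
  ultimately have "s < m1" using ineq by (simp add: algebra_simps)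
  moreover have "s \<ge> f i" unfolding s_def using i by (intro member_le_sum) (auto simp: f_def)
  moreover have "f i \<ge> 1" using i f1 by auto
  ultimately show ?thesis using that[OF j(1)] j(2) by (simp add: s_def f_def)
qed

definition annihilates :: "(int \<Rightarrow>\<^sub>0 int) \<Rightarrow> (int \<Rightarrow> complex) \<Rightarrow> bool" where
  "annihilates q g \<longleftrightarrow>
     (\<forall>k. (\<Sum>i\<in>Poly_Mapping.keys q. of_int (Poly_Mapping.lookup q i) * g (k + i)) = 0)"

definition bounded_digits :: "(int \<Rightarrow> int) \<Rightarrow> int \<Rightarrow> real \<Rightarrow> bool" where
  "bounded_digits c R B \<longleftrightarrow> (\<forall>k. \<bar>real_of_int (c k)\<bar> \<le> B) \<and> (\<forall>k. R < \<bar>k\<bar> \<longrightarrow> c k = 0)"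

definition digit_sum :: "(int \<Rightarrow> int) \<Rightarrow> int \<Rightarrow> (int \<Rightarrow> complex) \<Rightarrow> complex" where
  "digit_sum c R g = (\<Sum>k\<in>{-R..R}. of_int (c k) * g k)"

lemma digit_sum_mono:
  assumes "R \<le> R'" "\<And>k. R < \<bar>k\<bar> \<Longrightarrow> c k = 0"
  shows "digit_sum c R' g = digit_sum c R g"
  unfolding digit_sum_def using assms by (intro sum.mono_neutral_right) auto

lemma digit_sum_shift:
  assumes u: "\<And>k. R < \<bar>k\<bar> \<Longrightarrow> u k = 0" and e: "\<bar>e\<bar> \<le> D"
  shows "digit_sum (\<lambda>k. u (k - e)) (R + D) g = digit_sum u R (\<lambda>k. g (k + e))"
proof -
  have "(\<Sum>k\<in>{-(R + D)..R + D}. of_int (u (k - e)) * g k)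
      = (\<Sum>k\<in>{-R + e..R + e}. of_int (u (k - e)) * g k)"
    using e u by (intro sum.mono_neutral_right) auto
  also have "\<dots> = (\<Sum>k\<in>{-R..R}. of_int (u k) * g (k + e))"
    by (rule sum.reindex_bij_witness[of _ "\<lambda>k. k + e" "\<lambda>k. k - e"]) auto
  finally show ?thesis by (simp add: digit_sum_def)
qed

locale dominant_coefficient =
  fixes q :: "int \<Rightarrow>\<^sub>0 int" and j :: int and D :: int
  assumes j: "j \<in> Poly_Mapping.keys q"
    and dominant: "(\<Sum>i\<in>Poly_Mapping.keys q - {j}. \<bar>Poly_Mapping.lookup q i\<bar>) < \<bar>Poly_Mapping.lookup q j\<bar>"
    and two_le: "2 \<le> \<bar>Poly_Mapping.lookup q j\<bar>"
    and width: "\<And>i. i \<in> Poly_Mapping.keys q \<Longrightarrow> \<bar>i - j\<bar> \<le> D"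
begin

definition a :: int where "a = \<bar>Poly_Mapping.lookup q j\<bar>"

lemma D_nonneg: "0 \<le> D" using width[OF j] by simp

text \<open>One round of carrying: divide every digit by the dominant coefficient and spread the quotient
  over the neighbouring positions with the help of the relation \<open>q\<close>.\<close>

lemma carry_step:
  assumes c: "bounded_digits c R B"
  shows "\<exists>c'. bounded_digits c' (R + D) ((a - 1) + (1 - 1 / a) * B) \<and>
           (\<forall>g. annihilates q g \<longrightarrow> digit_sum c' (R + D) g = digit_sum c R g)"
proof -
  let ?I = "Poly_Mapping.keys q - {j}"
  define s where "s = sgn (Poly_Mapping.lookup q j)"
  \<comment> \<open>Division truncated towards zero. Rounding a negative digit down could make the
    quotient larger than \<open>\<bar>c k\<bar> / a\<close> in absolute value and spoil the
    contraction.\<close>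
  define u where "u k = sgn (c k) * (\<bar>c k\<bar> div a)" for k
  define r where "r k = sgn (c k) * (\<bar>c k\<bar> mod a)" for k
  define c' where "c' k = r k - (\<Sum>i\<in>?I. s * Poly_Mapping.lookup q i * u (k - (i - j)))" for k
  have a2: "a \<ge> 2" using two_le by (simp add: a_def)
  have c_eq: "c k = r k + a * u k" for k
  proof -
    have "r k + a * u k = sgn (c k) * (\<bar>c k\<bar> mod a + a * (\<bar>c k\<bar> div a))"
      unfolding r_def u_def distrib_left by (simp only: mult.left_commute)
    also have "\<bar>c k\<bar> mod a + a * (\<bar>c k\<bar> div a) = \<bar>c k\<bar>" by simp
    finally show ?thesis by (simp add: sgn_mult_abs)
  qed
  have supp: "u k = 0" "r k = 0" if "R < \<bar>k\<bar>" for k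
    using that c by (auto simp: u_def r_def bounded_digits_def)
  have r_le: "\<bar>r k\<bar> \<le> a - 1" for k
    using a2 pos_mod_bound[of a "\<bar>c k\<bar>"] pos_mod_sign[of a "\<bar>c k\<bar>"]
    by (auto simp: r_def abs_mult sgn_if)
  have u_le: "\<bar>real_of_int (u k)\<bar> \<le> B / a" for k
  proof -
    have "\<bar>u k\<bar> \<le> \<bar>c k\<bar> div a"
      using a2 by (auto simp: u_def abs_mult sgn_if pos_imp_zdiv_nonneg_iff)
    then have "\<bar>real_of_int (u k)\<bar> \<le> real_of_int (\<bar>c k\<bar> div a)"
      by (metis of_int_abs of_int_le_iff)
    also have "\<dots> \<le> real_of_int \<bar>c k\<bar> / a" by (rule real_of_int_div4)
    also have "\<dots> \<le> B / a"
      using c a2 by (intro divide_right_mono) (auto simp: bounded_digits_def)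
    finally show ?thesis .
  qed
  have B0: "0 \<le> B" using c by (force simp: bounded_digits_def)
  have "bounded_digits c' (R + D) ((a - 1) + (1 - 1 / a) * B)"
    unfolding bounded_digits_def
  proof (intro conjI allI impI)
    fix k
    have "\<bar>real_of_int (c' k)\<bar> \<le> \<bar>real_of_int (r k)\<bar>
        + (\<Sum>i\<in>?I. \<bar>real_of_int (s * Poly_Mapping.lookup q i * u (k - (i - j)))\<bar>)"
      unfolding c'_def of_int_diff of_int_sum
      by (rule order_trans[OF abs_triangle_ineq4]) (intro add_left_mono sum_abs)
    also have "\<dots> \<le> (a - 1) + (\<Sum>i\<in>?I. \<bar>real_of_int (Poly_Mapping.lookup q i)\<bar> * (B / a))"
    proof (intro add_mono sum_mono)
      show "\<bar>real_of_int (r k)\<bar> \<le> a - 1" using r_le[of k] by linarith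
      fix i
      have "\<bar>real_of_int s\<bar> \<le> 1" by (auto simp: s_def sgn_if)
      then have "\<bar>real_of_int s\<bar> * (\<bar>real_of_int (Poly_Mapping.lookup q i)\<bar> * \<bar>real_of_int (u (k - (i - j)))\<bar>)
          \<le> 1 * (\<bar>real_of_int (Poly_Mapping.lookup q i)\<bar> * (B / a))"
        using u_le by (intro mult_mono) auto
      then show "\<bar>real_of_int (s * Poly_Mapping.lookup q i * u (k - (i - j)))\<bar>
          \<le> \<bar>real_of_int (Poly_Mapping.lookup q i)\<bar> * (B / a)"
        by (simp add: abs_mult mult.assoc)
    qed
    also have "\<dots> = (a - 1) + real_of_int (\<Sum>i\<in>?I. \<bar>Poly_Mapping.lookup q i\<bar>) * (B / a)"
      by (simp add: sum_distrib_right sum_divide_distrib)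
    also have "\<dots> \<le> (a - 1) + real_of_int (a - 1) * (B / a)"
    proof (intro add_left_mono mult_right_mono)
      \<comment> \<open>Integrality sharpens strict dominance to \<open>a - 1\<close>; divided by
        \<open>a\<close> this is the contraction factor \<open>1 - 1 / a\<close>.\<close>
      have "(\<Sum>i\<in>?I. \<bar>Poly_Mapping.lookup q i\<bar>) \<le> a - 1"
        using dominant by (simp add: a_def)
      then show "real_of_int (\<Sum>i\<in>?I. \<bar>Poly_Mapping.lookup q i\<bar>) \<le> real_of_int (a - 1)"
        by (simp only: of_int_le_iff)
    qed (use B0 a2 in auto)
    also have "\<dots> = (a - 1) + (1 - 1 / a) * B"
      using a2 by (simp add: field_simps)
    finally show "\<bar>real_of_int (c' k)\<bar> \<le> (a - 1) + (1 - 1 / a) * B" .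
  next
    fix k assume k: "R + D < \<bar>k\<bar>"
    have "u (k - (i - j)) = 0" if "i \<in> ?I" for i
      using k width[of i] that by (intro supp) auto
    moreover have "r k = 0" using k D_nonneg by (intro supp) auto
    ultimately show "c' k = 0" by (simp add: c'_def)
  qed
  moreover have "digit_sum c' (R + D) g = digit_sum c R g" if g: "annihilates q g" for g
  proof -
    \<comment> \<open>The relation solved for its dominant term; the sign \<open>s\<close> makes
      that coefficient the positive number \<open>a\<close>.\<close>
    have rel: "(\<Sum>i\<in>?I. of_int (s * Poly_Mapping.lookup q i) * g (k + (i - j))) = - (of_int a * g k)" for k
    proof -
      have "0 = (\<Sum>i\<in>Poly_Mapping.keys q. of_int (Poly_Mapping.lookup q i) * g (k - j + i))"
        using g unfolding annihilates_def by metis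
      also have "\<dots> = of_int (Poly_Mapping.lookup q j) * g k
          + (\<Sum>i\<in>?I. of_int (Poly_Mapping.lookup q i) * g (k - j + i))"
        using j by (simp add: sum.remove)
      finally have *: "(\<Sum>i\<in>?I. of_int (Poly_Mapping.lookup q i) * g (k - j + i))
          = - (of_int (Poly_Mapping.lookup q j) * g k)"
        by (simp only: eq_neg_iff_add_eq_0 add.commute)
      have "(\<Sum>i\<in>?I. of_int (s * Poly_Mapping.lookup q i) * g (k + (i - j)))
          = of_int s * (\<Sum>i\<in>?I. of_int (Poly_Mapping.lookup q i) * g (k - j + i))"
        unfolding sum_distrib_left by (intro sum.cong refl) (simp add: algebra_simps)
      also have "\<dots> = - (of_int (s * Poly_Mapping.lookup q j) * g k)"
        unfolding * by simp
      also have "s * Poly_Mapping.lookup q j = a" by (simp add: s_def a_def sgn_if)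
      finally show ?thesis .
    qed
    have "digit_sum c' (R + D) g = digit_sum r (R + D) g
        - (\<Sum>i\<in>?I. of_int (s * Poly_Mapping.lookup q i) * digit_sum (\<lambda>k. u (k - (i - j))) (R + D) g)"
      unfolding digit_sum_def c'_def sum_distrib_left
      by (subst sum.swap) (simp add: sum_subtractf sum_distrib_left algebra_simps)
    also have "digit_sum r (R + D) g = digit_sum r R g"
      using D_nonneg supp by (intro digit_sum_mono) auto
    also have "(\<Sum>i\<in>?I. of_int (s * Poly_Mapping.lookup q i) * digit_sum (\<lambda>k. u (k - (i - j))) (R + D) g)
        = (\<Sum>i\<in>?I. of_int (s * Poly_Mapping.lookup q i) * digit_sum u R (\<lambda>k. g (k + (i - j))))"
      by (intro sum.cong refl arg_cong2[where f = "(*)"] digit_sum_shift supp) (use width in auto)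
    also have "\<dots> = (\<Sum>k\<in>{-R..R}. of_int (u k) * (\<Sum>i\<in>?I. of_int (s * Poly_Mapping.lookup q i) * g (k + (i - j))))"
      unfolding digit_sum_def sum_distrib_left
      by (subst sum.swap) (simp add: algebra_simps)
    also have "\<dots> = - (\<Sum>k\<in>{-R..R}. of_int (a * u k) * g k)"
      unfolding rel by (simp add: sum_negf algebra_simps)
    also have "digit_sum r R g - - (\<Sum>k\<in>{-R..R}. of_int (a * u k) * g k) = digit_sum c R g"
      by (simp add: digit_sum_def c_eq sum.distrib algebra_simps)
    finally show ?thesis .
  qed
  ultimately show ?thesis by blast
qed

text \<open>\<open>a * (a - 1)\<close> is the fixed point of the map
  \<open>B \<mapsto> (a - 1) + (1 - 1 / a) * B\<close> from \<open>carry_step\<close>; the excess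
  over it shrinks geometrically.\<close>

lemma carry_iterate:
  assumes c: "bounded_digits c R B"
  shows "\<exists>c'. bounded_digits c' (R + int m * D) (a * (a - 1) + (1 - 1 / a) ^ m * B) \<and>
           (\<forall>g. annihilates q g \<longrightarrow> digit_sum c' (R + int m * D) g = digit_sum c R g)"
proof (induction m)
  case 0
  have "real_of_int (a * (a - 1)) \<ge> 0" using two_le by (simp add: a_def)
  then show ?case using c by (intro exI[of _ c]) (force simp: bounded_digits_def intro: order_trans)
next
  case (Suc m)
  then obtain c' where c': "bounded_digits c' (R + int m * D) (a * (a - 1) + (1 - 1 / a) ^ m * B)"
    "\<And>g. annihilates q g \<Longrightarrow> digit_sum c' (R + int m * D) g = digit_sum c R g" by blast
  have "real_of_int (a - 1) + (1 - 1 / a) * (a * (a - 1) + (1 - 1 / a) ^ m * B)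
      = a * (a - 1) + (1 - 1 / a) ^ Suc m * B"
    using two_le by (simp add: a_def field_simps)
  moreover obtain c'' where
    "bounded_digits c'' (R + int m * D + D) ((a - 1) + (1 - 1 / a) * (a * (a - 1) + (1 - 1 / a) ^ m * B))"
    "\<And>g. annihilates q g \<Longrightarrow> digit_sum c'' (R + int m * D + D) g = digit_sum c' (R + int m * D) g"
    using carry_step[OF c'(1)] by auto
  moreover have "R + int m * D + D = R + int (Suc m) * D" by (simp add: algebra_simps)
  ultimately show ?case using c'(2) by (intro exI[of _ c'']) simp
qed

text \<open>With \<open>x = 1 - 1 / a\<close>, the excess after \<open>m\<close> rounds is at most
  x^m * m^2, which is bounded in \<open>m\<close>. The bound \<open>B\<close> precedes all other
  quantifiers, and \<open>c'\<close> is chosen before \<open>g\<close>: one carried digit sequence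
  serves every coordinate of an orbit.\<close>

lemma carry:
  "\<exists>B. \<forall>c R n m. bounded_digits c R (real n) \<longrightarrow> n \<le> m ^ 2 \<longrightarrow>
     (\<exists>c'. bounded_digits c' (R + int m * D) B \<and>
        (\<forall>g. annihilates q g \<longrightarrow> digit_sum c' (R + int m * D) g = digit_sum c R g))"
proof -
  define x where "x = 1 - 1 / real_of_int a"
  have x: "0 \<le> x" "x < 1" using two_le by (auto simp: x_def a_def)
  \<comment> \<open>x^m * m^2 is the square of this sequence.\<close>
  have "(\<lambda>m. real m * sqrt x ^ m) \<longlonglongrightarrow> 0"
    by (rule powser_times_n_limit_0) (use x in simp)
  then have "Bseq (\<lambda>m. real m * sqrt x ^ m)"
    by (intro convergent_imp_Bseq convergentI)
  then obtain L where L: "\<And>m. norm (real m * sqrt x ^ m) \<le> L"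
    by (meson BseqE)
  have "bounded_digits c R (real n) \<longrightarrow> n \<le> m ^ 2 \<longrightarrow>
     (\<exists>c'. bounded_digits c' (R + int m * D) (a * (a - 1) + L\<^sup>2) \<and>
        (\<forall>g. annihilates q g \<longrightarrow> digit_sum c' (R + int m * D) g = digit_sum c R g))" for c R n m
  proof (intro impI)
    assume c: "bounded_digits c R (real n)" and nm: "n \<le> m ^ 2"
    have "x ^ m * real n \<le> x ^ m * (real m)\<^sup>2"
      using nm x by (intro mult_left_mono) (auto simp flip: of_nat_power)
    also have "\<dots> = (norm (real m * sqrt x ^ m))\<^sup>2"
      using x by (simp add: power_mult_distrib flip: power_mult) (simp add: power_mult mult.commute[of m 2])
    also have "\<dots> \<le> L\<^sup>2" using L by (intro power_mono) auto
    finally have le: "x ^ m * real n \<le> L\<^sup>2" .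
    obtain c' where "bounded_digits c' (R + int m * D) (a * (a - 1) + x ^ m * real n)"
      "\<forall>g. annihilates q g \<longrightarrow> digit_sum c' (R + int m * D) g = digit_sum c R g"
      using carry_iterate[OF c, of m] by (auto simp: x_def)
    with le show "\<exists>c'. bounded_digits c' (R + int m * D) (a * (a - 1) + L\<^sup>2) \<and>
        (\<forall>g. annihilates q g \<longrightarrow> digit_sum c' (R + int m * D) g = digit_sum c R g)"
      by (intro exI[of _ c']) (force simp: bounded_digits_def intro: order_trans)
  qed
  then show ?thesis by blast
qed

end

section \<open>Word length\<close>

context group
begin

abbreviation word_product :: "'a list \<Rightarrow> 'a" where
  "word_product ws \<equiv> foldr (\<lambda>x y. x \<otimes> y) ws \<one>"

lemma word_product_closed: "set ws \<subseteq> carrier G \<Longrightarrow> word_product ws \<in> carrier G"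
  by (induction ws) auto

lemma word_product_append:
  "set ws \<subseteq> carrier G \<Longrightarrow> set vs \<subseteq> carrier G \<Longrightarrow>
    word_product (ws @ vs) = word_product ws \<otimes> word_product vs"
  by (induction ws) (auto simp: m_assoc word_product_closed)

lemma word_exists:
  assumes "sym_gen_set G S" "g \<in> carrier G"
  shows "\<exists>ws. set ws \<subseteq> S \<and> word_product ws = g"
proof -
  have S: "S \<subseteq> carrier G" "\<And>s. s \<in> S \<Longrightarrow> inv s \<in> S" and "g \<in> generate G S"
    using assms by (auto simp: sym_gen_set_def)
  from this(3) show ?thesis
  proof (induction rule: generate.induct)
    case one
    then show ?case by (intro exI[of _ "[]"]) auto
  next
    case (incl h)
    then show ?case using S by (intro exI[of _ "[h]"]) auto
  next
    case (inv h)
    then show ?case using S by (intro exI[of _ "[inv h]"]) auto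
  next
    case (eng h1 h2)
    then obtain ws vs where "set ws \<subseteq> S" "word_product ws = h1" "set vs \<subseteq> S" "word_product vs = h2"
      by blast
    then show ?case using word_product_append[of ws vs] S(1)
      by (intro exI[of _ "ws @ vs"]) (auto simp del: foldr_append)
  qed
qed

lemma word_length_le:
  "set ws \<subseteq> S \<Longrightarrow> word_product ws = g \<Longrightarrow> word_length G S g \<le> length ws"
  unfolding word_length_def by (intro Least_le) blast

lemma word_length_witness:
  assumes "sym_gen_set G S" "g \<in> carrier G"
  obtains ws where "set ws \<subseteq> S" "length ws = word_length G S g" "word_product ws = g"
proof -
  have "\<exists>n. \<exists>ws. set ws \<subseteq> S \<and> length ws = n \<and> word_product ws = g"
    using word_exists[OF assms] by blast
  from LeastI_ex[OF this] show ?thesis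
    using that unfolding word_length_def by blast
qed

lemma word_length_mult:
  assumes S: "sym_gen_set G S" and "g \<in> carrier G" "h \<in> carrier G"
  shows "word_length G S (g \<otimes> h) \<le> word_length G S g + word_length G S h"
proof -
  obtain ws vs where "set ws \<subseteq> S" "length ws = word_length G S g" "word_product ws = g"
    and "set vs \<subseteq> S" "length vs = word_length G S h" "word_product vs = h"
    using word_length_witness assms by metis
  moreover have "S \<subseteq> carrier G" using S by (simp add: sym_gen_set_def)
  ultimately show ?thesis
    using word_length_le[of "ws @ vs" S "g \<otimes> h"] word_product_append[of ws vs]
    by (auto simp del: foldr_append)
qed

lemma word_length_one [simp]: "word_length G S \<one> = 0"
  using word_length_le[of "[]" S \<one>] by simp

text \<open>Needed for measurability of the walk, where the product of two random group elements is
  treated value by value.\<close>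

lemma countable_carrier:
  assumes "sym_gen_set G S"
  shows "countable (carrier G)"
proof -
  have "countable (lists S)"
    using assms by (auto simp: sym_gen_set_def intro: countable_lists countable_finite)
  moreover have "carrier G \<subseteq> word_product ` lists S"
    using word_exists[OF assms] by (force simp: lists_eq_set)
  ultimately show ?thesis by (meson countable_image countable_subset)
qed

lemma fin_generated_sym_gen_set:
  assumes "fin_generated G"
  shows "\<exists>S. sym_gen_set G S"
proof -
  obtain S where S: "finite S" "S \<subseteq> carrier G" "generate G S = carrier G"
    using assms by (auto simp: fin_generated_def)
  let ?T = "S \<union> (\<lambda>s. inv s) ` S"
  have T: "?T \<subseteq> carrier G" using S by auto
  have "generate G S \<subseteq> generate G ?T" by (intro mono_generate) auto
  moreover have "generate G ?T \<subseteq> carrier G" using T by (rule generate_incl)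
  ultimately have "sym_gen_set G ?T"
    using S T by (auto simp: sym_gen_set_def)
  then show ?thesis by blast
qed

text \<open>Supplies the existence of an adapted law: the uniform distribution on a symmetric set is
  invariant under inversion.\<close>

lemma sym_gen_set_adapted:
  assumes S: "sym_gen_set G S" and "S \<noteq> {}"
  shows "adapted G (pmf_of_set S)"
proof -
  have S': "finite S" "S \<subseteq> carrier G" "generate G S = carrier G" "\<And>s. s \<in> S \<Longrightarrow> inv s \<in> S"
    using S by (auto simp: sym_gen_set_def)
  have "inv g \<in> S \<longleftrightarrow> g \<in> S" if "g \<in> carrier G" for g
    using S'(4)[of "inv g"] S'(4)[of g] that by auto
  then show ?thesis
    using S' assms(2) by (auto simp: adapted_def indicator_def)
qed

end

section \<open>Integer iterates of a bijection\<close>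

lemma inv_into_funpow_closed:
  "bij_betw f A A \<Longrightarrow> x \<in> A \<Longrightarrow> (inv_into A f ^^ n) x \<in> A"
  by (induction n) (auto simp: bij_betw_def intro: inv_into_into)

lemma funpow_closed: "bij_betw f A A \<Longrightarrow> x \<in> A \<Longrightarrow> (f ^^ n) x \<in> A"
  by (induction n) (auto simp: bij_betw_def)

lemma int_iterate_closed: "bij_betw f A A \<Longrightarrow> x \<in> A \<Longrightarrow> int_iterate A f m x \<in> A"
  by (simp add: int_iterate_def inv_into_funpow_closed funpow_closed)

lemma int_iterate_0 [simp]: "int_iterate A f 0 x = x"
  by (simp add: int_iterate_def)

text \<open>One recursion for both signs. Together with injectivity of \<open>f\<close> it lets
  later facts be proved by two-sided induction from 0 without unfolding
  \<open>inv_into\<close>.\<close>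

lemma int_iterate_add_one:
  assumes "bij_betw f A A" "x \<in> A"
  shows "int_iterate A f (m + 1) x = f (int_iterate A f m x)"
proof (cases "0 \<le> m")
  case True
  then have "nat (m + 1) = Suc (nat m)" by simp
  then show ?thesis using True by (simp add: int_iterate_def)
next
  case False
  then obtain n where m: "m = - int (Suc n)" by (cases m) auto
  have "f (inv_into A f ((inv_into A f ^^ n) x)) = (inv_into A f ^^ n) x"
    using inv_into_funpow_closed[OF assms, of n] assms(1) by (intro f_inv_into_f) (auto simp: bij_betw_def)
  moreover have "nat (- m) = Suc n" "m + 1 = - int n" using m by auto
  ultimately show ?thesis using m by (simp add: int_iterate_def)
qed

lemma int_iterate_add:
  assumes "bij_betw f A A" "x \<in> A"
  shows "int_iterate A f (m + n) x = int_iterate A f m (int_iterate A f n x)"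
proof (induction m rule: int_induct[where k = 0])
  case (step1 m)
  have "int_iterate A f (m + 1 + n) x = f (int_iterate A f (m + n) x)"
    using int_iterate_add_one[OF assms, of "m + n"] by (simp add: ac_simps)
  then show ?case
    using step1 int_iterate_add_one[OF assms(1) int_iterate_closed[OF assms]] by simp
next
  case (step2 m)
  have "f (int_iterate A f (m - 1 + n) x) = int_iterate A f (m + n) x"
    using int_iterate_add_one[OF assms, of "m - 1 + n"] by simp
  also have "\<dots> = f (int_iterate A f (m - 1) (int_iterate A f n x))"
    using step2 int_iterate_add_one[OF assms(1) int_iterate_closed[OF assms], of "m - 1" n] by simp
  finally show ?case
    using inj_onD[OF bij_betw_imp_inj_on[OF assms(1)]] assms
    by (blast intro: int_iterate_closed)
qed simp

section \<open>The groups \<open>\<int>[\<rho>]\<^sup>d \<rtimes> \<int>\<close>\<close>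

lemma int_adjoin_add:
  assumes "x \<in> int_adjoin \<rho>" "y \<in> int_adjoin \<rho>"
  shows "x + y \<in> int_adjoin \<rho>"
proof -
  obtain p q where "x = poly (map_poly of_int p) \<rho>" "y = poly (map_poly of_int q) \<rho>"
    using assms by (auto simp: int_adjoin_def)
  then have "x + y = poly (map_poly of_int (p + q)) \<rho>"
    by (simp add: of_int_poly_hom.hom_add)
  then show ?thesis unfolding int_adjoin_def by blast
qed

lemma int_adjoin_mult:
  assumes "x \<in> int_adjoin \<rho>" "y \<in> int_adjoin \<rho>"
  shows "x * y \<in> int_adjoin \<rho>"
proof -
  obtain p q where "x = poly (map_poly of_int p) \<rho>" "y = poly (map_poly of_int q) \<rho>"
    using assms by (auto simp: int_adjoin_def)
  then have "x * y = poly (map_poly of_int (p * q)) \<rho>"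
    by (simp add: of_int_poly_hom.hom_mult)
  then show ?thesis unfolding int_adjoin_def by blast
qed

lemma int_adjoin_of_int: "of_int c \<in> int_adjoin \<rho>"
proof -
  have "of_int c = poly (map_poly of_int [:c:]) \<rho>"
    by (cases "c = 0") (simp_all add: map_poly_pCons)
  then show ?thesis unfolding int_adjoin_def by blast
qed

lemma int_adjoin_sum: "(\<And>i. i \<in> I \<Longrightarrow> f i \<in> int_adjoin \<rho>) \<Longrightarrow> (\<Sum>i\<in>I. f i) \<in> int_adjoin \<rho>"
  using int_adjoin_of_int[of 0]
  by (induction I rule: infinite_finite_induct) (auto intro: int_adjoin_add)

locale free_mod_automorphism =
  fixes \<rho> :: complex and d :: nat and \<phi> :: "complex Matrix.vec \<Rightarrow> complex Matrix.vec"
  assumes automorphism: "linear_automorphism \<rho> d \<phi>"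
begin

abbreviation V :: "complex Matrix.vec set" where "V \<equiv> free_mod \<rho> d"
abbreviation \<psi> :: "int \<Rightarrow> complex Matrix.vec \<Rightarrow> complex Matrix.vec" where "\<psi> \<equiv> int_iterate V \<phi>"
abbreviation G :: "(complex Matrix.vec \<times> int) monoid" where "G \<equiv> semidirect \<rho> d \<phi>"

text \<open>Formed coordinatewise, so that the dimension is \<open>d\<close> even for an empty index
  set.\<close>

definition combination :: "'i set \<Rightarrow> ('i \<Rightarrow> complex) \<Rightarrow> ('i \<Rightarrow> complex Matrix.vec) \<Rightarrow> complex Matrix.vec" where
  "combination I a u = Matrix.vec d (\<lambda>l. \<Sum>i\<in>I. a i * vec_index (u i) l)"

lemma V_dim: "v \<in> V \<Longrightarrow> dim_vec v = d"
  by (auto simp: free_mod_def)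

lemma V_carrier: "v \<in> V \<Longrightarrow> v \<in> carrier_vec d"
  by (auto simp: free_mod_def)

lemma V_index: "v \<in> V \<Longrightarrow> l < d \<Longrightarrow> vec_index v l \<in> int_adjoin \<rho>"
  by (auto simp: free_mod_def)

lemma V_add: "v \<in> V \<Longrightarrow> w \<in> V \<Longrightarrow> v + w \<in> V"
  by (auto simp: free_mod_def int_adjoin_add)

lemma V_smult: "a \<in> int_adjoin \<rho> \<Longrightarrow> v \<in> V \<Longrightarrow> a \<cdot>\<^sub>v v \<in> V"
  by (auto simp: free_mod_def int_adjoin_mult)

lemma V_zero: "0\<^sub>v d \<in> V"
  using int_adjoin_of_int[of 0] by (auto simp: free_mod_def)

lemma V_uminus: "v \<in> V \<Longrightarrow> - v \<in> V"
  using V_smult[of "- 1" v] int_adjoin_of_int[of "- 1" \<rho>]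
  by (auto simp: free_mod_def)

lemma V_combination:
  "(\<And>i. i \<in> I \<Longrightarrow> a i \<in> int_adjoin \<rho>) \<Longrightarrow> (\<And>i. i \<in> I \<Longrightarrow> u i \<in> V) \<Longrightarrow> combination I a u \<in> V"
  by (auto simp: combination_def free_mod_def intro!: int_adjoin_sum int_adjoin_mult)

lemma bij_\<phi>: "bij_betw \<phi> V V"
  using automorphism by (simp add: linear_automorphism_def)

lemma \<psi>_closed: "v \<in> V \<Longrightarrow> \<psi> m v \<in> V"
  by (rule int_iterate_closed[OF bij_\<phi>])

lemmas \<psi>_add_one = int_iterate_add_one[OF bij_\<phi>]
lemmas \<psi>_add = int_iterate_add[OF bij_\<phi>]

lemma \<phi>_inj: "v \<in> V \<Longrightarrow> w \<in> V \<Longrightarrow> \<phi> v = \<phi> w \<Longrightarrow> v = w"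
  using bij_\<phi> by (auto simp: bij_betw_def dest: inj_onD)

lemma \<phi>_linear:
  "v \<in> V \<Longrightarrow> w \<in> V \<Longrightarrow> \<phi> (v + w) = \<phi> v + \<phi> w"
  "a \<in> int_adjoin \<rho> \<Longrightarrow> v \<in> V \<Longrightarrow> \<phi> (a \<cdot>\<^sub>v v) = a \<cdot>\<^sub>v \<phi> v"
  using automorphism by (auto simp: linear_automorphism_def)

lemma \<phi>_\<psi>_pred: "v \<in> V \<Longrightarrow> \<phi> (\<psi> (m - 1) v) = \<psi> m v"
  using \<psi>_add_one[of v "m - 1"] by simp

text \<open>The downward step is verified after applying \<open>\<phi>\<close>, which is injective
  on \<open>V\<close>.\<close>

lemma \<psi>_additive:
  assumes "v \<in> V" "w \<in> V"
  shows "\<psi> m (v + w) = \<psi> m v + \<psi> m w"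
proof (induction m rule: int_induct[where k = 0])
  case (step1 m)
  then show ?case
    using assms by (simp add: \<psi>_add_one V_add \<phi>_linear \<psi>_closed)
next
  case (step2 m)
  have "\<phi> (\<psi> (m - 1) (v + w)) = \<phi> (\<psi> (m - 1) v + \<psi> (m - 1) w)"
    using step2 assms by (simp add: V_add \<phi>_linear \<psi>_closed \<phi>_\<psi>_pred)
  then show ?case using assms by (blast intro: \<phi>_inj V_add \<psi>_closed)
qed simp

lemma \<psi>_smult:
  assumes "v \<in> V" "a \<in> int_adjoin \<rho>"
  shows "\<psi> m (a \<cdot>\<^sub>v v) = a \<cdot>\<^sub>v \<psi> m v"
proof (induction m rule: int_induct[where k = 0])
  case (step1 m)
  then show ?case
    using assms by (simp add: \<psi>_add_one V_smult \<phi>_linear \<psi>_closed)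
next
  case (step2 m)
  have "\<phi> (\<psi> (m - 1) (a \<cdot>\<^sub>v v)) = \<phi> (a \<cdot>\<^sub>v \<psi> (m - 1) v)"
    using step2 assms by (simp add: V_smult \<phi>_linear \<psi>_closed \<phi>_\<psi>_pred)
  then show ?case using assms by (blast intro: \<phi>_inj V_smult \<psi>_closed)
qed simp

lemma \<psi>_combination:
  assumes "finite I" "\<And>i. i \<in> I \<Longrightarrow> a i \<in> int_adjoin \<rho>" "\<And>i. i \<in> I \<Longrightarrow> u i \<in> V" and l: "l < d"
  shows "vec_index (\<psi> m (combination I a u)) l = (\<Sum>i\<in>I. a i * vec_index (\<psi> m (u i)) l)"
  using assms(1-3)
proof (induction I)
  case empty
  have "combination {} a u = 0 \<cdot>\<^sub>v 0\<^sub>v d" by (auto simp: combination_def)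
  moreover have "0 \<in> int_adjoin \<rho>" using int_adjoin_of_int[of 0] by simp
  ultimately have "\<psi> m (combination {} a u) = 0 \<cdot>\<^sub>v \<psi> m (0\<^sub>v d)"
    using \<psi>_smult[OF V_zero] by simp
  then show ?case using l V_dim[OF \<psi>_closed[OF V_zero]] by simp
next
  case (insert i I)
  have V: "u i \<in> V" "a i \<cdot>\<^sub>v u i \<in> V" "combination I a u \<in> V"
    using insert by (auto intro: V_smult V_combination)
  have "combination (insert i I) a u = a i \<cdot>\<^sub>v u i + combination I a u"
    using insert V by (intro eq_vecI) (auto simp: combination_def V_dim)
  then have "\<psi> m (combination (insert i I) a u) = a i \<cdot>\<^sub>v \<psi> m (u i) + \<psi> m (combination I a u)"
    using V insert by (simp add: \<psi>_additive \<psi>_smult)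
  then show ?case
    using insert l V by (simp add: V_dim \<psi>_closed)
qed

lemma \<phi>_matrix:
  assumes v: "v \<in> V" and i: "i < d"
  shows "vec_index (\<phi> v) i = (\<Sum>j<d. matrix_of d \<phi> $$ (i, j) * vec_index v j)"
proof -
  have uv: "unit_vec d j \<in> V" if "j < d" for j
    using int_adjoin_of_int[of 0] int_adjoin_of_int[of 1] that
    by (auto simp: free_mod_def unit_vec_def)
  have "v = combination {..<d} (vec_index v) (unit_vec d)"
    using V_dim[OF v] by (intro eq_vecI) (auto simp: combination_def if_distrib cong: if_cong)
  then have "vec_index (\<psi> 1 v) i = (\<Sum>j<d. vec_index v j * vec_index (\<psi> 1 (unit_vec d j)) i)"
    using \<psi>_combination[of "{..<d}" "vec_index v" "unit_vec d" i 1] V_index[OF v] uv i by simp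
  then show ?thesis
    using i by (simp add: matrix_of_def int_iterate_def mult.commute)
qed

text \<open>Coordinates of an orbit satisfy the recurrence of the characteristic polynomial, and
  therefore that of every Laurent multiple, whatever complex cofactor is involved.\<close>

lemma annihilates_orbit:
  assumes q: "integral_multiple (char_poly_of d \<phi>) q" and v: "v \<in> V" and l: "l < d"
  shows "annihilates q (\<lambda>k. vec_index (\<psi> k v) l)"
  unfolding annihilates_def
proof
  fix k
  let ?g = "\<lambda>l k. vec_index (\<psi> k v) l"
  have "poly_act (char_poly_of d \<phi>) (?g l) k = 0" for k
    unfolding char_poly_of_def
  proof (rule cayley_hamilton_orbit[where g = ?g and n = d])
    show "matrix_of d \<phi> \<in> carrier_mat d d" by (simp add: matrix_of_def)
    fix i k assume "i < d"
    then show "?g i (k + 1) = (\<Sum>j<d. matrix_of d \<phi> $$ (i, j) * ?g j k)"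
      using v by (simp add: \<psi>_add_one \<phi>_matrix \<psi>_closed)
  qed (use l in auto)
  then have "laurent_act (laurent_of_poly (char_poly_of d \<phi>)) (?g l) k = 0" for k
    by (simp only: laurent_act_of_poly)
  then have "laurent_act (Poly_Mapping.map of_int q) (?g l) k = 0"
    by (rule laurent_act_dvd_zero[OF q[unfolded integral_multiple_def]])
  moreover have "Poly_Mapping.lookup (Poly_Mapping.map of_int q) i = (of_int (Poly_Mapping.lookup q i) :: complex)" for i
    by (simp add: Poly_Mapping.map.rep_eq when_def)
  moreover have "Poly_Mapping.keys (Poly_Mapping.map of_int q :: int \<Rightarrow>\<^sub>0 complex) = Poly_Mapping.keys q"
    using calculation(2) by (auto simp: in_keys_iff)
  ultimately show "(\<Sum>i\<in>Poly_Mapping.keys q. of_int (Poly_Mapping.lookup q i) * ?g l (k + i)) = 0"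
    by (simp add: laurent_act_def)
qed

lemma G_simps:
  "carrier G = V \<times> UNIV"
  "(v, m) \<otimes>\<^bsub>G\<^esub> (w, n) = (v + \<psi> m w, m + n)"
  "\<one>\<^bsub>G\<^esub> = (0\<^sub>v d, 0)"
  by (simp_all add: semidirect_def)

lemma \<psi>_zero: "\<psi> m (0\<^sub>v d) = 0\<^sub>v d"
proof -
  have "0 \<in> int_adjoin \<rho>" using int_adjoin_of_int[of 0] by simp
  then have "\<psi> m (0 \<cdot>\<^sub>v 0\<^sub>v d) = 0 \<cdot>\<^sub>v \<psi> m (0\<^sub>v d)" by (intro \<psi>_smult V_zero)
  moreover have "0 \<cdot>\<^sub>v \<psi> m (0\<^sub>v d) = 0\<^sub>v d"
    using V_dim[OF \<psi>_closed[OF V_zero, of m]] by (intro eq_vecI) auto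
  moreover have "0 \<cdot>\<^sub>v 0\<^sub>v d = (0\<^sub>v d :: complex Matrix.vec)" by auto
  ultimately show ?thesis by simp
qed

lemma group_G: "group G"
proof (rule groupI)
  fix x y assume "x \<in> carrier G" "y \<in> carrier G"
  then show "x \<otimes>\<^bsub>G\<^esub> y \<in> carrier G"
    by (cases x; cases y) (auto simp: G_simps intro: V_add \<psi>_closed)
next
  fix x y z assume xyz: "x \<in> carrier G" "y \<in> carrier G" "z \<in> carrier G"
  show "x \<otimes>\<^bsub>G\<^esub> y \<otimes>\<^bsub>G\<^esub> z = x \<otimes>\<^bsub>G\<^esub> (y \<otimes>\<^bsub>G\<^esub> z)"
  proof (cases x; cases y; cases z)
    fix u k v m w n assume eq: "x = (u, k)" "y = (v, m)" "z = (w, n)"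
    then have "u \<in> V" "v \<in> V" "w \<in> V" using xyz by (auto simp: G_simps)
    then have "u + \<psi> k v + \<psi> (k + m) w = u + \<psi> k (v + \<psi> m w)"
      by (simp add: \<psi>_additive \<psi>_closed \<psi>_add assoc_add_vec[of _ d] V_carrier)
    then show ?thesis by (simp add: eq G_simps)
  qed
next
  fix x assume x: "x \<in> carrier G"
  then show "\<one>\<^bsub>G\<^esub> \<otimes>\<^bsub>G\<^esub> x = x"
    by (cases x) (auto simp: G_simps V_carrier)
  show "\<exists>y\<in>carrier G. y \<otimes>\<^bsub>G\<^esub> x = \<one>\<^bsub>G\<^esub>"
  proof (cases x)
    case (Pair v m)
    then have "v \<in> V" using x by (auto simp: G_simps)
    moreover have "- \<psi> (- m) v + \<psi> (- m) v = 0\<^sub>v d"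
      using V_carrier[OF \<psi>_closed[OF \<open>v \<in> V\<close>]] by (intro uminus_l_inv_vec)
    moreover have "- \<psi> (- m) v \<in> V" using \<open>v \<in> V\<close> by (intro V_uminus \<psi>_closed)
    ultimately have "(- \<psi> (- m) v, - m) \<in> carrier G" "(- \<psi> (- m) v, - m) \<otimes>\<^bsub>G\<^esub> x = \<one>\<^bsub>G\<^esub>"
      by (simp_all add: Pair G_simps)
    then show ?thesis by blast
  qed
next
  show "\<one>\<^bsub>G\<^esub> \<in> carrier G" by (simp add: G_simps V_zero)
qed

lemma snd_mult: "snd (g \<otimes>\<^bsub>G\<^esub> h) = snd g + snd h"
  by (cases g; cases h) (simp add: G_simps)

lemma snd_inv: "g \<in> carrier G \<Longrightarrow> snd (inv\<^bsub>G\<^esub> g) = - snd g"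
  using snd_mult[of "inv\<^bsub>G\<^esub> g" g] by (simp add: group.l_inv[OF group_G] G_simps)


lemma G_closed: "v \<in> V \<Longrightarrow> (v, m) \<in> carrier G"
  by (simp add: G_simps)

lemma word_length_translation:
  assumes S: "sym_gen_set G S"
  shows "word_length G S (0\<^sub>v d, n) \<le>
    nat \<bar>n\<bar> * (word_length G S (0\<^sub>v d, 1) + word_length G S (0\<^sub>v d, - 1))"
    (is "_ \<le> _ * ?T")
proof -
  interpret group G by (rule group_G)
  have step: "word_length G S (0\<^sub>v d, m + e) \<le> word_length G S (0\<^sub>v d, m) + ?T" if "e \<in> {1, -1}" for m e
  proof -
    have "(0\<^sub>v d, m + e) = (0\<^sub>v d, m) \<otimes>\<^bsub>G\<^esub> (0\<^sub>v d, e)"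
      by (simp add: G_simps \<psi>_zero)
    then have "word_length G S (0\<^sub>v d, m + e) \<le> word_length G S (0\<^sub>v d, m) + word_length G S (0\<^sub>v d, e)"
      using word_length_mult[OF S G_closed[OF V_zero] G_closed[OF V_zero]] by simp
    then show ?thesis using that by auto
  qed
  show ?thesis
  proof (induction n rule: int_induct[where k = 0])
    case base
    then show ?case using word_length_one[of S] by (simp add: G_simps)
  next
    case (step1 i)
    then have "nat \<bar>i + 1\<bar> = Suc (nat \<bar>i\<bar>)" by simp
    then show ?case using step1 step[of 1 i] by simp
  next
    case (step2 i)
    then have "nat \<bar>i - 1\<bar> = Suc (nat \<bar>i\<bar>)" by simp
    then show ?case using step2 step[of "- 1" i] by simp
  qed
qed

text \<open>Horner's scheme: sweep over the interval from \<open>-R\<close> to \<open>R\<close>, depositing one digit at each site.\<close>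

lemma word_length_digits:
  assumes S: "sym_gen_set G S" and W: "finite W" "W \<subseteq> V"
  shows "\<exists>C::real. 0 \<le> C \<and> (\<forall>R w u m. (\<forall>k. w k \<in> W) \<longrightarrow> \<bar>m\<bar> \<le> R \<longrightarrow> u \<in> V \<longrightarrow>
    (\<forall>l<d. vec_index u l = (\<Sum>k\<in>{-R..R}. vec_index (\<psi> k (w k)) l)) \<longrightarrow>
    real (word_length G S (u, m)) \<le> C * real_of_int (R + 1))"
proof -
  interpret group G by (rule group_G)
  define T where "T = word_length G S (0\<^sub>v d, 1) + word_length G S (0\<^sub>v d, - 1)"
  define L where "L = (\<Sum>x\<in>W. word_length G S (x, 0))"
  have L: "word_length G S (x, 0) \<le> L" if "x \<in> W" for x
    unfolding L_def using that W by (intro member_le_sum) auto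
  have trans: "word_length G S (0\<^sub>v d, n) \<le> nat \<bar>n\<bar> * T" for n
    using word_length_translation[OF S] by (simp add: T_def)
  \<comment> \<open>In units of \<open>R + 1\<close>: \<open>T\<close> for walking to
    \<open>-R\<close>, \<open>2 * (L + T)\<close> for the deposits with one move each, and
    \<open>2 * T\<close> for the way back to \<open>m\<close>.\<close>
  have "real (word_length G S (u, m)) \<le> real (5 * T + 2 * L) * real_of_int (R + 1)"
    if w: "\<And>k. w k \<in> W" and m: "\<bar>m\<bar> \<le> R" and u: "u \<in> V"
      and u_eq: "\<And>l. l < d \<Longrightarrow> vec_index u l = (\<Sum>k\<in>{-R..R}. vec_index (\<psi> k (w k)) l)" for R w u m
  proof -
    have wV: "w k \<in> V" for k using w W by blast
    have sweep: "\<exists>h\<in>V. (\<forall>l<d. vec_index h l = (\<Sum>k\<in>{-R..<-R + int j}. vec_index (\<psi> k (w k)) l)) \<and>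
        word_length G S (h, -R + int j) \<le> nat R * T + j * (L + T)" for j
    proof (induction j)
      case 0
      have "word_length G S (0\<^sub>v d, - R) \<le> nat R * T"
        using trans[of "-R"] m by simp
      then show ?case using V_zero by (intro bexI[of _ "0\<^sub>v d"]) auto
    next
      case (Suc j)
      then obtain h where h: "h \<in> V"
        "\<And>l. l < d \<Longrightarrow> vec_index h l = (\<Sum>k\<in>{-R..<-R + int j}. vec_index (\<psi> k (w k)) l)"
        "word_length G S (h, -R + int j) \<le> nat R * T + j * (L + T)" by blast
      define x where "x = \<psi> (-R + int j) (w (-R + int j))"
      have x: "x \<in> V" unfolding x_def by (intro \<psi>_closed wV)
      have "(h, -R + int j) \<otimes>\<^bsub>G\<^esub> (w (-R + int j), 0) = (h + x, -R + int j)"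
        by (simp add: G_simps x_def)
      then have "word_length G S (h + x, -R + int j) \<le> word_length G S (h, -R + int j) + L"
        using word_length_mult[OF S G_closed[OF h(1), of "-R + int j"] G_closed[OF wV, of "-R + int j" 0]]
          L[OF w, of "-R + int j"] by simp
      moreover have "(h + x, -R + int j) \<otimes>\<^bsub>G\<^esub> (0\<^sub>v d, 1) = (h + x, -R + int (Suc j))"
        using V_carrier[OF V_add[OF h(1) x]] by (simp add: G_simps \<psi>_zero)
      then have "word_length G S (h + x, -R + int (Suc j)) \<le> word_length G S (h + x, -R + int j) + T"
        using word_length_mult[OF S G_closed[OF V_add[OF h(1) x], of "-R + int j"] G_closed[OF V_zero, of 1]]
          trans[of 1] by simp
      ultimately have "word_length G S (h + x, -R + int (Suc j)) \<le> nat R * T + Suc j * (L + T)"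
        using h(3) by simp
      moreover have "vec_index (h + x) l = (\<Sum>k\<in>{-R..<-R + int (Suc j)}. vec_index (\<psi> k (w k)) l)"
        if l: "l < d" for l
      proof -
        have "{-R..<-R + int (Suc j)} = insert (-R + int j) {-R..<-R + int j}" by auto
        then show ?thesis using h(2)[OF l] l V_dim[OF x] by (simp add: x_def)
      qed
      ultimately show ?case using V_add[OF h(1) x] by blast
    qed
    \<comment> \<open>After \<open>2 * R + 1\<close> deposits the cursor stands at
      \<open>R + 1\<close>, one past the last site; the remaining way to \<open>m\<close> has length
      at most \<open>2 * R + 1\<close>.\<close>
    obtain h where h: "h \<in> V"
      "\<And>l. l < d \<Longrightarrow> vec_index h l = (\<Sum>k\<in>{-R..<-R + int (nat (2 * R + 1))}. vec_index (\<psi> k (w k)) l)"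
      "word_length G S (h, -R + int (nat (2 * R + 1))) \<le> nat R * T + nat (2 * R + 1) * (L + T)"
      using sweep by blast
    have "{-R..<-R + int (nat (2 * R + 1))} = {-R..R}" using m by auto
    then have "h = u"
      using h(2) u_eq V_dim[OF h(1)] V_dim[OF u] by (intro eq_vecI) auto
    moreover have "-R + int (nat (2 * R + 1)) = R + 1" using m by simp
    ultimately have len: "word_length G S (u, R + 1) \<le> nat R * T + nat (2 * R + 1) * (L + T)"
      using h(3) by simp
    have "(u, R + 1) \<otimes>\<^bsub>G\<^esub> (0\<^sub>v d, m - R - 1) = (u, m)"
      using V_carrier[OF u] by (simp add: G_simps \<psi>_zero)
    then have "word_length G S (u, m) \<le> word_length G S (u, R + 1) + word_length G S (0\<^sub>v d, m - R - 1)"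
      using word_length_mult[OF S G_closed[OF u, of "R + 1"] G_closed[OF V_zero, of "m - R - 1"]] by simp
    also have "\<dots> \<le> (nat R * T + nat (2 * R + 1) * (L + T)) + nat (2 * R + 1) * T"
    proof (rule add_mono[OF len order_trans[OF trans]])
      show "nat \<bar>m - R - 1\<bar> * T \<le> nat (2 * R + 1) * T"
        using m by (intro mult_right_mono) auto
    qed
    also have "\<dots> \<le> nat (R + 1) * T + (2 * nat (R + 1)) * (L + T) + (2 * nat (R + 1)) * T"
      using m by (intro add_mono mult_right_mono) auto
    also have "\<dots> = (5 * T + 2 * L) * nat (R + 1)" by (simp add: algebra_simps)
    finally have "real (word_length G S (u, m)) \<le> real ((5 * T + 2 * L) * nat (R + 1))"
      by (simp only: of_nat_le_iff)
    also have "\<dots> = real (5 * T + 2 * L) * (R + 1)" using m by simp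
    finally show ?thesis .
  qed
  then show ?thesis by (intro exI[of _ "real (5 * T + 2 * L)"]) auto
qed

section \<open>Word length along the walk\<close>

lemma walk_closed: "(\<And>i. i < n \<Longrightarrow> \<omega> i \<in> carrier G) \<Longrightarrow> walk G n \<omega> \<in> carrier G"
proof (induction n)
  case 0
  then show ?case using group.is_monoid[OF group_G] by (simp add: monoid.one_closed)
next
  case (Suc n)
  then show ?case using group.is_monoid[OF group_G] by (simp add: monoid.m_closed)
qed

lemma snd_walk: "snd (walk G n \<omega>) = (\<Sum>i<n. snd (\<omega> i))"
  by (induction n) (simp_all add: snd_mult, simp add: G_simps)

text \<open>Unfolding the semidirect product: increment \<open>i\<close> is deposited at the
  position reached before step \<open>i\<close>.\<close>

lemma fst_walk_index:
  assumes "\<And>i. i < n \<Longrightarrow> \<omega> i \<in> carrier G" "l < d"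
  shows "vec_index (fst (walk G n \<omega>)) l = (\<Sum>i<n. vec_index (\<psi> (snd (walk G i \<omega>)) (fst (\<omega> i))) l)"
  using assms(1)
proof (induction n)
  case 0
  then show ?case using assms(2) by (simp add: G_simps)
next
  case (Suc n)
  obtain v m where w: "walk G n \<omega> = (v, m)" by force
  obtain u k where o: "\<omega> n = (u, k)" by force
  have "v \<in> V" "u \<in> V"
    using walk_closed[of n \<omega>] Suc.prems[of n] Suc.prems w o by (auto simp: G_simps)
  then have "dim_vec (\<psi> m u) = d" by (intro V_dim \<psi>_closed)
  then show ?case using Suc assms(2) w o by (simp add: G_simps)
qed

text \<open>Deposits are counted by module part f and position k. Carrying is done separately for
  each f, and then the bounded digits at one position are merged into a single element of the finite
  set \<open>W\<close>. The cost per site is therefore a constant independent of path and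
  time.\<close>

lemma word_length_walk_upper:
  assumes S: "sym_gen_set G S" and A: "finite A" "A \<subseteq> carrier G"
    and q: "integral_multiple (char_poly_of d \<phi>) q" "EDP q"
  shows "\<exists>C>0::real. \<forall>n \<omega> R. (\<forall>i<n. \<omega> i \<in> A) \<longrightarrow> (\<forall>k\<le>n. \<bar>snd (walk G k \<omega>)\<bar> \<le> R) \<longrightarrow>
    real (word_length G S (walk G n \<omega>)) \<le> C * (real_of_int R + sqrt n + 1)"
proof -
  obtain j where j: "j \<in> Poly_Mapping.keys q"
    "(\<Sum>i\<in>Poly_Mapping.keys q - {j}. \<bar>Poly_Mapping.lookup q i\<bar>) < \<bar>Poly_Mapping.lookup q j\<bar>"
    "2 \<le> \<bar>Poly_Mapping.lookup q j\<bar>"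
    using EDP_dominant_coefficient[OF q(2)] by blast
  define D where "D = (\<Sum>i\<in>Poly_Mapping.keys q. \<bar>i - j\<bar>)"
  interpret dominant_coefficient q j D
    by unfold_locales (use j in \<open>auto simp: D_def intro: member_le_sum\<close>)
  obtain B where B: "\<And>c R n m. bounded_digits c R (real n) \<Longrightarrow> n \<le> m ^ 2 \<Longrightarrow>
     (\<exists>c'. bounded_digits c' (R + int m * D) B \<and>
        (\<forall>g. annihilates q g \<longrightarrow> digit_sum c' (R + int m * D) g = digit_sum c R g))"
    using carry by blast
  define F where "F = fst ` A"
  have F: "finite F" "F \<subseteq> V" using A by (auto simp: F_def G_simps)
  define digit where "digit a = combination F (\<lambda>f. of_int (a f)) (\<lambda>f. f)" for a
  have digit_V: "digit a \<in> V" for a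
    unfolding digit_def using F by (intro V_combination int_adjoin_of_int) auto
  define W where "W = digit ` (F \<rightarrow>\<^sub>E {-\<lfloor>B\<rfloor>..\<lfloor>B\<rfloor>})"
  have W: "finite W" "W \<subseteq> V"
    using F digit_V by (auto simp: W_def intro!: finite_PiE)
  obtain C :: real where C: "C \<ge> 0" "\<forall>R w u m. (\<forall>k. w k \<in> W) \<longrightarrow> \<bar>m\<bar> \<le> R \<longrightarrow> u \<in> V \<longrightarrow>
    (\<forall>l<d. vec_index u l = (\<Sum>k\<in>{-R..R}. vec_index (\<psi> k (w k)) l)) \<longrightarrow>
    real (word_length G S (u, m)) \<le> C * real_of_int (R + 1)"
    using word_length_digits[OF S W] by (elim exE conjE)
  \<comment> \<open>The added 1 keeps the constant positive when \<open>C\<close> is 0.\<close>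
  have "real (word_length G S (walk G n \<omega>)) \<le> (C * (D + 1) + 1) * (real_of_int R + sqrt n + 1)"
    if \<omega>: "\<And>i. i < n \<Longrightarrow> \<omega> i \<in> A" and R: "\<And>k. k \<le> n \<Longrightarrow> \<bar>snd (walk G k \<omega>)\<bar> \<le> R" for n \<omega> R
  proof -
    have \<omega>G: "\<omega> i \<in> carrier G" if "i < n" for i using \<omega>[OF that] A by blast
    define c where "c f k = int (card {i \<in> {..<n}. (fst (\<omega> i), snd (walk G i \<omega>)) = (f, k)})" for f k
    have c: "bounded_digits (c f) R (real n)" for f
      unfolding bounded_digits_def
    proof (intro conjI allI impI)
      fix k
      have "card {i \<in> {..<n}. (fst (\<omega> i), snd (walk G i \<omega>)) = (f, k)} \<le> card {..<n}"
        by (intro card_mono) auto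
      then show "\<bar>real_of_int (c f k)\<bar> \<le> real n" by (simp add: c_def)
    next
      fix k assume "R < \<bar>k\<bar>"
      then have "{i \<in> {..<n}. (fst (\<omega> i), snd (walk G i \<omega>)) = (f, k)} = {}"
        using R by (auto simp: not_le[symmetric])
      then show "c f k = 0" by (simp only: c_def card.empty)
    qed
    \<comment> \<open>The rounding serves both needs: \<open>n \<le> m ^ 2\<close> for
      \<open>carry\<close>, and \<open>m \<le> sqrt n + 1\<close> for the width of the
      support.\<close>
    define m where "m = nat \<lceil>sqrt n\<rceil>"
    have "sqrt n \<le> real m" by (simp add: m_def)
    then have "(sqrt n)\<^sup>2 \<le> (real m)\<^sup>2" by (intro power_mono) auto
    then have nm: "n \<le> m ^ 2" by (simp flip: of_nat_power)
    define R' where "R' = R + int m * D"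
    obtain c' where c': "\<And>f. bounded_digits (c' f) R' B"
      "\<And>f g. annihilates q g \<Longrightarrow> digit_sum (c' f) R' g = digit_sum (c f) R g"
      using B[OF c nm] unfolding R'_def by metis
    define w where "w k = digit (restrict (\<lambda>f. c' f k) F)" for k
    have w: "w k \<in> W" for k
    proof -
      have "\<bar>real_of_int (c' f k)\<bar> \<le> B" for f using c'(1) by (auto simp: bounded_digits_def)
      then have "\<bar>c' f k\<bar> \<le> \<lfloor>B\<rfloor>" for f
        by (simp add: le_floor_iff)
      then have "c' f k \<in> {-\<lfloor>B\<rfloor>..\<lfloor>B\<rfloor>}" for f
        by (simp add: abs_le_iff minus_le_iff)
      then show ?thesis by (auto simp: w_def W_def)
    qed
    have R': "\<bar>snd (walk G n \<omega>)\<bar> \<le> R'"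
      using R[of n] mult_nonneg_nonneg[OF of_nat_0_le_iff D_nonneg, of m]
      unfolding R'_def by linarith
    have eq: "vec_index (fst (walk G n \<omega>)) l = (\<Sum>k\<in>{-R'..R'}. vec_index (\<psi> k (w k)) l)" if l: "l < d" for l
    proof -
      have "vec_index (fst (walk G n \<omega>)) l
          = (\<Sum>i<n. (\<lambda>(f, k). vec_index (\<psi> k f) l) (fst (\<omega> i), snd (walk G i \<omega>)))"
        using fst_walk_index[OF \<omega>G l] by simp
      also have "\<dots> = (\<Sum>y\<in>F \<times> {-R..R}. of_nat (card {i \<in> {..<n}. (fst (\<omega> i), snd (walk G i \<omega>)) = y})
          * (\<lambda>(f, k). vec_index (\<psi> k f) l) y)"
      proof (rule sum_fun_comp)
        show "(\<lambda>i. (fst (\<omega> i), snd (walk G i \<omega>))) ` {..<n} \<subseteq> F \<times> {-R..R}"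
        proof (rule image_subsetI)
          fix i assume "i \<in> {..<n}"
          then have "fst (\<omega> i) \<in> F" "\<bar>snd (walk G i \<omega>)\<bar> \<le> R"
            using \<omega> R[of i] by (auto simp: F_def)
          then show "(fst (\<omega> i), snd (walk G i \<omega>)) \<in> F \<times> {-R..R}" by auto
        qed
      qed (use F in auto)
      also have "\<dots> = (\<Sum>(f, k)\<in>F \<times> {-R..R}. of_int (c f k) * vec_index (\<psi> k f) l)"
        by (intro sum.cong refl) (auto simp: c_def)
      also have "\<dots> = (\<Sum>f\<in>F. digit_sum (c f) R (\<lambda>k. vec_index (\<psi> k f) l))"
        by (simp add: digit_sum_def sum.cartesian_product)
      also have "\<dots> = (\<Sum>f\<in>F. digit_sum (c' f) R' (\<lambda>k. vec_index (\<psi> k f) l))"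
        using annihilates_orbit[OF q(1) _ l] F by (intro sum.cong refl c'(2)[symmetric]) auto
      also have "\<dots> = (\<Sum>k\<in>{-R'..R'}. \<Sum>f\<in>F. of_int (c' f k) * vec_index (\<psi> k f) l)"
        unfolding digit_sum_def by (rule sum.swap)
      also have "\<dots> = (\<Sum>k\<in>{-R'..R'}. vec_index (\<psi> k (w k)) l)"
      proof (intro sum.cong refl)
        fix k
        show "(\<Sum>f\<in>F. of_int (c' f k) * vec_index (\<psi> k f) l) = vec_index (\<psi> k (w k)) l"
          unfolding w_def digit_def
          using F l by (subst \<psi>_combination) (auto intro: int_adjoin_of_int)
      qed
      finally show ?thesis .
    qed
    have "fst (walk G n \<omega>) \<in> V"
      using walk_closed[of n \<omega>] \<omega>G by (simp add: G_simps mem_Times_iff)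
    then have "real (word_length G S (walk G n \<omega>)) \<le> C * (R' + 1)"
      using C(2)[rule_format, of w "snd (walk G n \<omega>)" R' "fst (walk G n \<omega>)"] w R' eq by simp
    also have "\<dots> \<le> C * ((D + 1) * (real_of_int R + sqrt n + 1))"
    proof (intro mult_left_mono C(1))
      have "real m = of_int \<lceil>sqrt n\<rceil>" by (simp add: m_def)
      then have "real m \<le> sqrt n + 1" by linarith
      then have "real m * real_of_int D \<le> (sqrt n + 1) * real_of_int D"
        using D_nonneg by (intro mult_right_mono) auto
      moreover have "0 \<le> R" using R[of 0] by auto
      then have "0 \<le> real_of_int D * real_of_int R" using D_nonneg by auto
      moreover have "0 \<le> sqrt n" by simp
      ultimately show "real_of_int (R' + 1) \<le> (D + 1) * (real_of_int R + sqrt n + 1)"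
        unfolding R'_def by (simp only: of_int_add of_int_mult of_int_1 of_int_of_nat_eq distrib_left distrib_right) argo
    qed
    also have "\<dots> \<le> (C * (D + 1) + 1) * (real_of_int R + sqrt n + 1)"
    proof -
      have "0 \<le> R" using R[of 0] by auto
      then show ?thesis by (simp add: algebra_simps)
    qed
    finally show ?thesis .
  qed
  moreover have "C * (D + 1) + 1 > 0"
    using C(1) D_nonneg by (intro add_nonneg_pos mult_nonneg_nonneg) auto
  ultimately show ?thesis by blast
qed

text \<open>The projection to the integers is a homomorphism, hence Lipschitz for the word length;
  the 1 in the constant keeps it positive.\<close>

lemma word_length_lower:
  assumes S: "sym_gen_set G S"
  shows "\<exists>C>0::real. \<forall>g\<in>carrier G. real_of_int \<bar>snd g\<bar> \<le> C * real (word_length G S g)"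
proof -
  interpret group G by (rule group_G)
  define C where "C = 1 + (\<Sum>s\<in>S. \<bar>snd s\<bar>)"
  have C: "\<bar>snd s\<bar> \<le> C" if "s \<in> S" for s
    unfolding C_def using S that by (intro add_increasing member_le_sum) (auto simp: sym_gen_set_def)
  have word: "\<bar>snd (word_product ws)\<bar> \<le> C * int (length ws)" if "set ws \<subseteq> S" for ws
    using that
  proof (induction ws)
    case (Cons s ws)
    then have "\<bar>snd (s \<otimes>\<^bsub>G\<^esub> word_product ws)\<bar> \<le> C + C * int (length ws)"
      using C[of s] abs_triangle_ineq[of "snd s" "snd (word_product ws)"] by (simp add: snd_mult)
    then show ?case by (simp add: algebra_simps)
  qed (simp add: G_simps)
  have "real_of_int \<bar>snd g\<bar> \<le> real_of_int C * real (word_length G S g)" if g: "g \<in> carrier G" for g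
  proof -
    obtain ws where ws: "set ws \<subseteq> S" "length ws = word_length G S g" "word_product ws = g"
      using word_length_witness[OF S g] by blast
    then have "\<bar>snd g\<bar> \<le> C * int (word_length G S g)" using word by metis
    then have "real_of_int \<bar>snd g\<bar> \<le> real_of_int (C * int (word_length G S g))"
      by (simp only: of_int_le_iff)
    then show ?thesis by simp
  qed
  moreover have "real_of_int C > 0" by (simp add: C_def add_pos_nonneg sum_nonneg)
  ultimately show ?thesis by blast
qed

text \<open>Otherwise the generated subgroup would lie in the kernel of the projection and miss
  \<open>(0\<^sub>v d, 1)\<close>. This gives positive variance of the projected step, and also that
  generating sets are nonempty.\<close>

lemma snd_surjective_generators:
  assumes "generate G A = carrier G" "A \<subseteq> carrier G"
  shows "\<exists>s\<in>A. snd s \<noteq> 0"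
proof (rule ccontr)
  assume "\<not> ?thesis"
  then have zero: "snd s = 0" if "s \<in> A" for s using that by blast
  have *: "snd g = 0" if "g \<in> generate G A" for g
    using that
  proof (induction rule: generate.induct)
    case (inv h)
    then show ?case using zero[of h] snd_inv[of h] assms(2) by auto
  qed (simp_all add: zero snd_mult, simp add: G_simps)
  have "(0\<^sub>v d, 1) \<in> generate G A"
    unfolding assms(1) by (rule G_closed[OF V_zero])
  from *[OF this] show False by simp
qed

end

section \<open>Escape exponents from a comparison with a walk on the line\<close>

lemma pl_extend_convex:
  fixes x :: real
  defines "k \<equiv> nat \<lfloor>x\<rfloor>"
  defines "t \<equiv> x - real k"
  shows "pl_extend f x = (1 - t) * f k + t * f (Suc k)"
  unfolding pl_extend_def Let_def t_def k_def by (simp add: algebra_simps)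

lemma pl_extend_le:
  assumes "x \<ge> 0" "\<And>n. f n \<le> c * g n"
  shows "pl_extend f x \<le> c * pl_extend g x"
proof -
  define k t where "k = nat \<lfloor>x\<rfloor>" and "t = x - real k"
  have kt: "0 \<le> t" "t \<le> 1" using assms(1) unfolding k_def t_def by (simp, linarith)
  note eq = pl_extend_convex[of _ x, folded k_def, folded t_def]
  have "(1 - t) * f k + t * f (Suc k) \<le> (1 - t) * (c * g k) + t * (c * g (Suc k))"
    using kt assms(2) by (intro add_mono mult_left_mono) auto
  then show ?thesis by (simp add: eq algebra_simps)
qed

lemma pl_extend_mono:
  assumes "mono f" "0 \<le> x" "x \<le> y"
  shows "pl_extend f x \<le> pl_extend f y"
proof -
  define k t where "k = nat \<lfloor>x\<rfloor>" and "t = x - real k"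
  define l s where "l = nat \<lfloor>y\<rfloor>" and "s = y - real l"
  have kt: "0 \<le> t" "t \<le> 1" using assms unfolding k_def t_def by (simp, linarith)
  have ls: "0 \<le> s" "s \<le> 1" using assms unfolding l_def s_def by (simp, linarith)
  note eq = pl_extend_convex[of f x, folded k_def, folded t_def]
  note eq' = pl_extend_convex[of f y, folded l_def, folded s_def]
  have f_mono: "f a \<le> f b" if "a \<le> b" for a b using assms(1) that by (auto dest: monoD)
  have "k \<le> l" unfolding k_def l_def using assms by (simp add: nat_mono floor_mono)
  then consider "k = l" | "Suc k \<le> l" by linarith
  then show ?thesis
  proof cases
    case 1
    then have "t \<le> s" using assms by (simp add: t_def s_def)
    then have "t * (f (Suc k) - f k) \<le> s * (f (Suc k) - f k)"
      using f_mono[of k "Suc k"] by (intro mult_right_mono) auto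
    then show ?thesis using 1 by (simp add: eq eq' algebra_simps)
  next
    case 2
    have "(1 - t) * f k + t * f (Suc k) \<le> (1 - t) * f (Suc k) + t * f (Suc k)"
      using kt f_mono by (intro add_mono mult_left_mono) auto
    also have "\<dots> = f (Suc k)" by (simp add: algebra_simps)
    also have "\<dots> \<le> f l" using f_mono 2 by auto
    also have "\<dots> = (1 - s) * f l + s * f l" by (simp add: algebra_simps)
    also have "\<dots> \<le> (1 - s) * f l + s * f (Suc l)"
      using ls f_mono by (intro add_mono mult_left_mono) auto
    finally show ?thesis by (simp add: eq eq')
  qed
qed

lemma growth_equiv_mono:
  assumes g: "mono g" "\<And>n. 0 \<le> g n" and f: "\<And>n. 0 \<le> f n"
    and fg: "\<And>n. f n \<le> a * g n" and gf: "\<And>n. g n \<le> b * f n"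
  shows "growth_equiv f g"
proof -
  define c where "c = max 1 (max a b)"
  have c: "c \<ge> 1" "a \<le> c" "b \<le> c" by (auto simp: c_def)
  have fg': "f n \<le> c * g n" and gf': "g n \<le> c * f n" for n
    using fg[of n] gf[of n] mult_right_mono[OF c(2) g(2)[of n]] mult_right_mono[OF c(3) f[of n]] by auto
  have mono: "pl_extend g x \<le> pl_extend g (c * x)" if "x \<ge> 0" for x
    using c that by (intro pl_extend_mono g) (auto simp: mult_le_cancel_right1)
  have "pl_extend f x \<le> c * pl_extend g (c * x)" if "x \<ge> 0" for x
  proof -
    have "pl_extend f x \<le> c * pl_extend g x" by (rule pl_extend_le[OF that fg'])
    also have "\<dots> \<le> c * pl_extend g (c * x)" using mono[OF that] c by (intro mult_left_mono) auto
    finally show ?thesis .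
  qed
  moreover have "pl_extend g x \<le> c * pl_extend f (c * x)" if "x \<ge> 0" for x
    using mono[OF that] pl_extend_le[of "c * x", OF _ gf'] that c by (meson mult_nonneg_nonneg order_trans zero_le_one)
  moreover have "c > 0" using c by simp
  ultimately show ?thesis
    unfolding growth_equiv_def growth_le_def by (intro conjI exI[of _ c]) auto
qed

lemma le_sum_indicator:
  assumes "y \<le> real N"
  shows "y \<le> (\<Sum>k<N. if real k < y then 1 else 0)"
  using assms
proof (induction N)
  case (Suc N)
  show ?case
  proof (cases "y \<le> real N")
    case True
    then show ?thesis using Suc.IH by auto
  next
    case False
    then have "(\<Sum>k<Suc N. if real k < y then 1 else 0) = (\<Sum>k<Suc N. 1 :: real)"
      by (intro sum.cong) auto
    then show ?thesis using Suc.prems by simp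
  qed
qed simp

text \<open>\<open>Y\<close> is at most the number of naturals k with k < \<open>Y\<close>, whose
  expectation is dominated by a geometric series. The bound \<open>B\<close> makes the count finite
  and does not enter the result.\<close>

lemma (in prob_space) expectation_le_of_tail:
  assumes Y [measurable]: "Y \<in> borel_measurable M" and bounded: "AE x in M. 0 \<le> Y x \<and> Y x \<le> B"
    and c: "c > 0" and "C \<ge> 0"
    and tail: "\<And>k::nat. prob {x \<in> space M. real k < Y x} \<le> C * exp (- c * real k)"
  shows "expectation Y \<le> C / (1 - exp (- c))"
proof -
  obtain N :: nat where N: "B \<le> real N" using real_arch_simple by blast
  have "expectation Y \<le> expectation (\<lambda>x. \<Sum>k<N. indicat_real {x \<in> space M. real k < Y x} x)"
  proof (rule integral_mono_AE)
    show "integrable M Y"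
      by (rule integrable_const_bound[where B = B]) (use bounded in auto)
    show "integrable M (\<lambda>x. \<Sum>k<N. indicat_real {x \<in> space M. real k < Y x} x)"
      by (intro Bochner_Integration.integrable_sum integrable_real_indicator) (auto simp: less_top[symmetric])
    show "AE x in M. Y x \<le> (\<Sum>k<N. indicat_real {x \<in> space M. real k < Y x} x)"
      using bounded AE_space
    proof eventually_elim
      case (elim x)
      then have "Y x \<le> (\<Sum>k<N. if real k < Y x then 1 else 0)"
        using N by (intro le_sum_indicator) auto
      moreover have "indicat_real {x \<in> space M. real k < Y x} x = (if real k < Y x then 1 else 0)" for k
        using elim by (simp add: indicator_def)
      ultimately show ?case by (simp only:)
    qed
  qed
  also have "\<dots> = (\<Sum>k<N. prob {x \<in> space M. real k < Y x})"
  proof -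
    have "expectation (\<lambda>x. \<Sum>k<N. indicat_real {x \<in> space M. real k < Y x} x)
        = (\<Sum>k<N. expectation (indicat_real {x \<in> space M. real k < Y x}))"
      by (intro Bochner_Integration.integral_sum integrable_real_indicator) (auto simp: less_top[symmetric])
    then show ?thesis by simp
  qed
  also have "\<dots> \<le> (\<Sum>k<N. C * exp (- c) ^ k)"
    using tail by (intro sum_mono) (simp flip: exp_of_nat_mult add: mult.commute)
  also have "\<dots> \<le> C * suminf (\<lambda>k. exp (- c) ^ k)"
    unfolding sum_distrib_left[symmetric] using c \<open>C \<ge> 0\<close>
    by (intro mult_left_mono sum_le_suminf summable_geometric) auto
  also have "\<dots> = C / (1 - exp (- c))"
    using c by (subst suminf_geometric) auto
  finally show ?thesis .
qed

text \<open>The interface between the group and the line. \<open>upper\<close> is an almost sure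
  statement because it needs the increments to lie in the support; it ranges over all bounds
  \<open>r\<close> on the partial sums, so no maximum has to be formed.\<close>

locale escape_comparison = centred_walk +
  fixes L :: "nat \<Rightarrow> 'a \<Rightarrow> nat" and a b :: real
  assumes measurable_L [measurable]: "\<And>n. (\<lambda>x. real (L n x)) \<in> borel_measurable M"
    and L_0: "x \<in> space M \<Longrightarrow> L 0 x = 0"
    and a_pos: "a > 0" and b_pos: "b > 0"
    and lower: "x \<in> space M \<Longrightarrow> \<bar>\<Sum>i<n. X i x\<bar> \<le> a * real (L n x)"
    and upper: "AE x in M. \<forall>n r. (\<forall>k\<le>n. \<bar>\<Sum>i<k. X i x\<bar> \<le> r) \<longrightarrow> real (L n x) \<le> b * (r + sqrt n + 1)"
begin

lemma L_lower_tail: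
  "\<exists>\<gamma>>0. \<exists>\<delta>>0. \<forall>n\<ge>1. \<delta> \<le> prob {x \<in> space M. real (L n x) > \<gamma> * sqrt n}"
proof -
  obtain \<gamma> \<delta> where \<gamma>: "\<gamma> > 0" "\<delta> > 0"
    "\<And>I. finite I \<Longrightarrow> I \<noteq> {} \<Longrightarrow> \<delta> \<le> prob {x \<in> space M. (\<Sum>i\<in>I. X i x) > \<gamma> * sqrt (card I)}"
    using one_sided_lower_bound by blast
  have "\<delta> \<le> prob {x \<in> space M. real (L n x) > \<gamma> / a * sqrt n}" if "n \<ge> 1" for n
  proof -
    have "\<delta> \<le> prob {x \<in> space M. (\<Sum>i<n. X i x) > \<gamma> * sqrt n}"
      using \<gamma>(3)[of "{..<n}"] that by (simp add: lessThan_empty_iff)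
    also have "\<dots> \<le> prob {x \<in> space M. real (L n x) > \<gamma> / a * sqrt n}"
    proof (rule finite_measure_mono)
      show "{x \<in> space M. (\<Sum>i<n. X i x) > \<gamma> * sqrt n} \<subseteq> {x \<in> space M. real (L n x) > \<gamma> / a * sqrt n}"
      proof clarify
        fix x assume x: "x \<in> space M" "(\<Sum>i<n. X i x) > \<gamma> * sqrt n"
        then have "\<gamma> * sqrt n < a * real (L n x)" using lower[of x n] by linarith
        then show "real (L n x) > \<gamma> / a * sqrt n" using a_pos by (simp add: field_simps)
      qed
    qed measurable
    finally show ?thesis .
  qed
  moreover have "\<gamma> / a > 0" using \<gamma> a_pos by simp
  ultimately show ?thesis using \<gamma>(2) by blast
qed

text \<open>For positive \<open>n\<close> put \<open>x = b * y\<close>. If \<open>L n\<close>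
  exceeds \<open>x * sqrt n\<close>, some partial sum has absolute value at least
  \<open>(y - 2) * sqrt n\<close>, as 1 <= sqrt n. Then 2 (y - 2)^2 >= y^2 - 8 turns the maximal
  inequality into a Gaussian tail in \<open>y\<close>; the 8 becomes the prefactor
  \<open>exp (2 / K\<^sup>2)\<close>, which also makes the claim trivial for
  \<open>y \<le> 2\<close>.\<close>

lemma L_upper_tail:
  assumes "x \<ge> 0"
  shows "prob {\<omega> \<in> space M. real (L n \<omega>) > x * sqrt n} \<le> 2 * exp (2 / K\<^sup>2) * exp (- (1 / (4 * K\<^sup>2 * b\<^sup>2)) * x\<^sup>2)"
    (is "_ \<le> ?rhs")
proof (cases "n = 0")
  case True
  then have "{\<omega> \<in> space M. real (L n \<omega>) > x * sqrt n} = {}" using L_0 by auto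
  then show ?thesis by (simp only: measure_empty) simp
next
  case False
  define y where "y = x / b"
  have y: "y \<ge> 0" "x = b * y" using assms b_pos by (auto simp: y_def)
  have rhs: "?rhs = 2 * exp (2 / K\<^sup>2 - y\<^sup>2 / (4 * K\<^sup>2))"
  proof -
    have "2 / K\<^sup>2 - y\<^sup>2 / (4 * K\<^sup>2) = 2 / K\<^sup>2 + - (1 / (4 * K\<^sup>2 * b\<^sup>2)) * x\<^sup>2"
      by (simp add: y_def power_divide)
    then show ?thesis by (simp only: exp_add mult.assoc)
  qed
  show ?thesis
  proof (cases "y \<le> 2")
    case True
    have "y\<^sup>2 \<le> 2\<^sup>2" using True y by (intro power_mono) auto
    then have "0 \<le> 2 / K\<^sup>2 - y\<^sup>2 / (4 * K\<^sup>2)" using K_pos by (simp add: field_simps)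
    then have "1 \<le> exp (2 / K\<^sup>2 - y\<^sup>2 / (4 * K\<^sup>2))" by simp
    then have "1 \<le> ?rhs" unfolding rhs by linarith
    then show ?thesis using prob_le_1 order_trans by blast
  next
    case False
    define l where "l = (y - 2) * sqrt n"
    have l: "l > 0" using False \<open>n \<noteq> 0\<close> by (simp add: l_def)
    have "prob {\<omega> \<in> space M. real (L n \<omega>) > x * sqrt n} \<le> prob {\<omega> \<in> space M. \<exists>k\<le>n. \<bar>\<Sum>i<k. X i \<omega>\<bar> \<ge> l}"
    proof (rule finite_measure_mono_AE)
      show "AE \<omega> in M. \<omega> \<in> {\<omega> \<in> space M. real (L n \<omega>) > x * sqrt n} \<longrightarrow>
          \<omega> \<in> {\<omega> \<in> space M. \<exists>k\<le>n. \<bar>\<Sum>i<k. X i \<omega>\<bar> \<ge> l}"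
        using upper
      proof eventually_elim
        case (elim \<omega>)
        show ?case
        proof (intro impI, rule ccontr)
          assume \<omega>: "\<omega> \<in> {\<omega> \<in> space M. real (L n \<omega>) > x * sqrt n}"
            and "\<omega> \<notin> {\<omega> \<in> space M. \<exists>k\<le>n. \<bar>\<Sum>i<k. X i \<omega>\<bar> \<ge> l}"
          then have "\<not> (\<exists>k\<le>n. \<bar>\<Sum>i<k. X i \<omega>\<bar> \<ge> l)" by blast
          then have "\<forall>k\<le>n. \<bar>\<Sum>i<k. X i \<omega>\<bar> \<le> l" by (meson linear)
          then have "real (L n \<omega>) \<le> b * (l + sqrt n + 1)" using elim by blast
          also have "\<dots> \<le> b * (l + sqrt n + sqrt n)"
            using \<open>n \<noteq> 0\<close> b_pos by (intro mult_left_mono) auto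
          also have "\<dots> = x * sqrt n" by (simp add: l_def y(2) algebra_simps)
          finally show False using \<omega> by simp
        qed
      qed
    qed measurable
    also have "\<dots> \<le> 2 * exp (- l\<^sup>2 / (2 * K\<^sup>2 * n))"
      using l \<open>n \<noteq> 0\<close> by (intro max_tail) auto
    also have "- l\<^sup>2 / (2 * K\<^sup>2 * n) = - (y - 2)\<^sup>2 / (2 * K\<^sup>2)"
      using \<open>n \<noteq> 0\<close> by (simp add: l_def power_mult_distrib)
    also have "2 * exp (- (y - 2)\<^sup>2 / (2 * K\<^sup>2)) \<le> ?rhs"
    proof -
      have "0 \<le> (y - 4)\<^sup>2" by simp
      then have "y\<^sup>2 - 8 \<le> 2 * (y - 2)\<^sup>2" by (simp add: power2_eq_square algebra_simps)
      then have "(y\<^sup>2 - 8) / (4 * K\<^sup>2) \<le> 2 * (y - 2)\<^sup>2 / (4 * K\<^sup>2)" by (rule divide_right_mono) simp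
      then have "- (y - 2)\<^sup>2 / (2 * K\<^sup>2) \<le> 2 / K\<^sup>2 - y\<^sup>2 / (4 * K\<^sup>2)"
        using K_pos by (simp add: diff_divide_distrib)
      then show ?thesis unfolding rhs by simp
    qed
    finally show ?thesis .
  qed
qed

lemma tight_degree_of_escape_L: "tight_degree_of_escape M L (1/2)"
proof -
  obtain \<gamma> \<delta> where "\<gamma> > 0" "\<delta> > 0" "\<forall>n\<ge>1. \<delta> \<le> prob {x \<in> space M. real (L n x) > \<gamma> * sqrt n}"
    using L_lower_tail by blast
  then have "\<exists>\<gamma> \<delta>. \<gamma> > 0 \<and> \<delta> > 0 \<and> (\<forall>n\<ge>1. measure M {\<omega> \<in> space M. real (L n \<omega>) > \<gamma> * real n powr (1/2)} \<ge> \<delta>)"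
    by (intro exI[of _ \<gamma>] exI[of _ \<delta>]) (auto simp: powr_half_sqrt)
  moreover have "\<exists>\<beta> c C. \<beta> > 0 \<and> c > 0 \<and> C > 0 \<and>
      (\<forall>x\<ge>0. \<forall>n. measure M {\<omega> \<in> space M. real (L n \<omega>) > x * real n powr (1/2)} \<le> C * exp (- c * x powr \<beta>))"
    using L_upper_tail K_pos b_pos
    by (intro exI[of _ 2] exI[of _ "1 / (4 * K\<^sup>2 * b\<^sup>2)"] exI[of _ "2 * exp (2 / K\<^sup>2)"])
       (auto simp: powr_half_sqrt)
  ultimately show ?thesis unfolding tight_degree_of_escape_def by blast
qed

text \<open>A crude linear bound, used for integrability and to cut off the tail sum in the
  expectation.\<close>

lemma L_bounded: "AE x in M. real (L n x) \<le> b * (K * n + sqrt n + 1)"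
proof -
  have "AE x in M. \<forall>k\<in>{..n}. \<bar>\<Sum>i<k. X i x\<bar> \<le> K * k"
    using bounded_sum[of "{..<k}" for k] by (intro AE_finite_allI) auto
  then show ?thesis using upper
  proof eventually_elim
    case (elim x)
    have "\<bar>\<Sum>i<k. X i x\<bar> \<le> K * n" if "k \<le> n" for k
    proof -
      have "\<bar>\<Sum>i<k. X i x\<bar> \<le> K * k" using elim that by auto
      also have "\<dots> \<le> K * n" using that K_pos by (intro mult_left_mono) auto
      finally show ?thesis .
    qed
    then show ?case using elim by blast
  qed
qed

lemma displacement_exponent_L: "displacement_exponent M L (1/2)"
proof -
  obtain \<gamma> \<delta> where \<gamma>: "\<gamma> > 0" "\<delta> > 0" "\<And>n. n \<ge> 1 \<Longrightarrow> \<delta> \<le> prob {x \<in> space M. real (L n x) > \<gamma> * sqrt n}"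
    using L_lower_tail by blast
  have int: "integrable M (\<lambda>x. real (L n x))" for n
    by (rule integrable_const_bound[where B = "b * (K * n + sqrt n + 1)"]) (use L_bounded in auto)
  define c where "c = 1 / (4 * K\<^sup>2 * b\<^sup>2)"
  define D where "D = 2 * exp (2 / K\<^sup>2) / (1 - exp (- c))"
  have c: "c > 0" using K_pos b_pos by (simp add: c_def)
  have up: "expectation (\<lambda>x. real (L n x)) \<le> D * sqrt n" for n
  proof (cases "n = 0")
    case True
    then have "expectation (\<lambda>x. real (L n x)) = expectation (\<lambda>x. 0)"
      using L_0 by (intro Bochner_Integration.integral_cong) auto
    then show ?thesis using True by simp
  next
    case False
    have "expectation (\<lambda>x. real (L n x) / sqrt n) \<le> D"
      unfolding D_def
    proof (rule expectation_le_of_tail[where B = "b * (K * n + sqrt n + 1) / sqrt n", OF _ _ c])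
      show "AE x in M. 0 \<le> real (L n x) / sqrt n \<and> real (L n x) / sqrt n \<le> b * (K * n + sqrt n + 1) / sqrt n"
        using L_bounded[of n] by eventually_elim (auto intro!: divide_right_mono)
      fix k :: nat
      have "{x \<in> space M. real k < real (L n x) / sqrt n} = {x \<in> space M. real (L n x) > real k * sqrt n}"
        using False by (auto simp: field_simps)
      then have "prob {x \<in> space M. real k < real (L n x) / sqrt n} \<le> 2 * exp (2 / K\<^sup>2) * exp (- c * (real k)\<^sup>2)"
        using L_upper_tail[of "real k" n] by (simp add: c_def)
      also have "\<dots> \<le> 2 * exp (2 / K\<^sup>2) * exp (- c * real k)"
      proof -
        \<comment> \<open>On natural numbers this weakens the Gaussian tail to a geometric
          one.\<close>
        have "real k \<le> (real k)\<^sup>2" by (cases k) (auto simp: power2_eq_square)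
        then show ?thesis using c by simp
      qed
      finally show "prob {x \<in> space M. real k < real (L n x) / sqrt n} \<le> 2 * exp (2 / K\<^sup>2) * exp (- c * real k)" .
    qed auto
    then show ?thesis using False by (simp add: field_simps)
  qed
  have lo: "sqrt n \<le> 1 / (\<gamma> * \<delta>) * expectation (\<lambda>x. real (L n x))" for n
  proof (cases "n = 0")
    case False
    let ?E = "{x \<in> space M. real (L n x) > \<gamma> * sqrt n}"
    have E: "?E \<in> events" by measurable
    have "\<gamma> * sqrt n * \<delta> \<le> \<gamma> * sqrt n * prob ?E"
      using \<gamma> False by (intro mult_left_mono) auto
    also have "\<dots> = expectation (\<lambda>x. \<gamma> * sqrt n * indicat_real ?E x)"
      using E by simp
    also have "\<dots> \<le> expectation (\<lambda>x. real (L n x))"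
    proof (rule integral_mono[OF _ int])
      show "integrable M (\<lambda>x. \<gamma> * sqrt n * indicat_real ?E x)"
        using E by (intro integrable_mult_right integrable_real_indicator) (auto simp: less_top[symmetric])
    qed (auto simp: indicator_def)
    finally show ?thesis using \<gamma> by (simp add: field_simps)
  next
    case True
    have "0 \<le> expectation (\<lambda>x. real (L n x))" by (rule Bochner_Integration.integral_nonneg) simp
    then show ?thesis using True \<gamma>(1,2) by simp
  qed
  show ?thesis
    unfolding displacement_exponent_def
  proof (rule growth_equiv_mono)
    show "mono (\<lambda>n. real n powr (1 / 2))" by (intro monoI powr_mono2) auto
    show "expectation (\<lambda>x. real (L n x)) \<le> D * real n powr (1 / 2)" for n
      using up[of n] by (simp add: powr_half_sqrt)
    show "real n powr (1 / 2) \<le> 1 / (\<gamma> * \<delta>) * expectation (\<lambda>x. real (L n x))" for n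
      using lo[of n] by (simp add: powr_half_sqrt)
  qed auto
qed

lemma iterated_log_law_L: "iterated_log_law M L (1/2)"
proof -
  obtain c where c: "c > 0" "AE x in M. \<exists>\<^sub>F n in sequentially. \<bar>\<Sum>i<n. X i x\<bar> \<ge> c * sqrt (n * ln (ln n))"
    using iterated_log_lower by blast
  \<comment> \<open>Once \<open>ln (ln n)\<close> is at least 1, both sqrt n and 1 are absorbed by
    the normalisation \<open>r n\<close>; this is the 2 in the final constant
    \<open>b * (4 * K + 2)\<close>.\<close>
  have large: "\<forall>\<^sub>F n in sequentially. 1 \<le> ln (ln (real n)) \<and> 1 \<le> real n"
    by (intro eventually_conj) real_asymp+
  define r where "r n = (real n * ln (ln (real n))) powr (1/2)" for n :: nat
  have r: "\<forall>\<^sub>F n in sequentially. r n = sqrt (n * ln (ln n)) \<and> 1 \<le> sqrt n \<and> sqrt n \<le> r n"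
    using large
  proof eventually_elim
    case (elim n)
    then have "real n * 1 \<le> real n * ln (ln n)" by (intro mult_left_mono) auto
    then show ?case using elim by (auto simp: r_def powr_half_sqrt)
  qed
  show ?thesis
    unfolding iterated_log_law_def r_def[symmetric]
    using c(2) iterated_log_upper upper AE_space
  proof eventually_elim
    case (elim x)
    have freq: "\<exists>\<^sub>F n in sequentially. c / a \<le> real (L n x) / r n"
      using frequently_eventually_conj[OF elim(1) r]
    proof (rule frequently_elim1)
      fix n
      assume n: "(r n = sqrt (n * ln (ln n)) \<and> 1 \<le> sqrt n \<and> sqrt n \<le> r n) \<and>
          c * sqrt (n * ln (ln n)) \<le> \<bar>\<Sum>i<n. X i x\<bar>"
      then have "c * r n \<le> \<bar>\<Sum>i<n. X i x\<bar>" by simp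
      also have "\<dots> \<le> a * real (L n x)" by (rule lower[OF elim(4)])
      finally have "c * r n \<le> a * real (L n x)" .
      moreover have "r n > 0" using n by linarith
      ultimately show "c / a \<le> real (L n x) / r n" using a_pos by (simp add: field_simps)
    qed
    have "ereal (c / a) \<le> limsup (\<lambda>n. ereal (real (L n x) / r n))"
    proof (rule ccontr)
      assume "\<not> ?thesis"
      then have "\<forall>\<^sub>F n in sequentially. ereal (real (L n x) / r n) < ereal (c / a)"
        by (intro Limsup_lessD) (simp add: not_le)
      with freq show False by (simp add: frequently_def not_le)
    qed
    moreover have "0 < ereal (c / a)" using c a_pos by simp
    moreover have "\<forall>\<^sub>F n in sequentially. ereal (real (L n x) / r n) \<le> ereal (b * (4 * K + 2))"
      using elim(2) r
    proof eventually_elim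
      case (elim n)
      then have "real (L n x) \<le> b * (4 * K * r n + sqrt n + 1)"
        using \<open>\<forall>n r. (\<forall>k\<le>n. \<bar>\<Sum>i<k. X i x\<bar> \<le> r) \<longrightarrow> real (L n x) \<le> b * (r + sqrt n + 1)\<close> by simp
      also have "\<dots> \<le> b * (4 * K * r n + r n + r n)"
      proof (intro mult_left_mono)
        show "4 * K * r n + sqrt n + 1 \<le> 4 * K * r n + r n + r n"
          using conjunct2[OF elim(2)] by linarith
      qed (use b_pos in simp)
      also have "\<dots> = b * (4 * K + 2) * r n" by (simp add: algebra_simps)
      finally have "real (L n x) \<le> b * (4 * K + 2) * r n" .
      moreover have "r n > 0" using elim by linarith
      ultimately show ?case by (simp add: divide_le_eq)
    qed
    then have "limsup (\<lambda>n. ereal (real (L n x) / r n)) \<le> ereal (b * (4 * K + 2))"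
      by (rule Limsup_bounded)
    moreover have "ereal (b * (4 * K + 2)) < \<infinity>" by simp
    ultimately show ?case by (intro conjI) order+
  qed
qed

end

section \<open>From the random walk on the group to the walk on the line\<close>

lemma indep_vars_PiM_component:
  fixes N :: "'b measure"
  assumes N: "prob_space N"
  defines "P \<equiv> \<Pi>\<^sub>M i\<in>(UNIV :: nat set). N"
  shows "prob_space.indep_vars P (\<lambda>_. N) (\<lambda>i \<omega>. \<omega> i) UNIV"
proof -
  interpret P: prob_space P unfolding P_def using N by (intro prob_space_PiM)
  have "distr P N (\<lambda>\<omega>. \<omega> i) = N" for i
    unfolding P_def by (rule distr_PiM_component) (use N in auto)
  then have "distr P (\<Pi>\<^sub>M i\<in>UNIV. N) (\<lambda>\<omega>. \<lambda>i\<in>UNIV. \<omega> i) = (\<Pi>\<^sub>M i\<in>UNIV. distr P N (\<lambda>\<omega>. \<omega> i))"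
    by (simp add: P_def distr_id restrict_UNIV)
  then show ?thesis
    by (subst P.indep_vars_iff_distr_eq_PiM) (auto simp: P_def)
qed

context free_mod_automorphism
begin

text \<open>Each part of adaptedness feeds one hypothesis on the projected walk: finite support
  gives boundedness, symmetry gives mean zero, and generation gives positive variance.\<close>

theorem adapted_has_escape_exponent:
  assumes \<mu>: "adapted G \<mu>" and q: "integral_multiple (char_poly_of d \<phi>) q" "EDP q"
  shows "has_escape_exponent G \<mu> (1/2)"
proof -
  interpret group G by (rule group_G)
  define A where "A = set_pmf \<mu>"
  have A: "finite A" "A \<subseteq> carrier G" "generate G A = carrier G"
    using \<mu> unfolding adapted_def A_def by blast+
  have "\<forall>g\<in>carrier G. pmf \<mu> g = pmf \<mu> (inv\<^bsub>G\<^esub> g)"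
    using \<mu> unfolding adapted_def by blast
  then have sym: "pmf \<mu> (inv\<^bsub>G\<^esub> g) = pmf \<mu> g" if "g \<in> carrier G" for g
    using that by metis
  have inv_A: "inv\<^bsub>G\<^esub> g \<in> A" if "g \<in> A" for g
    using that A(2) sym[of g] by (auto simp: A_def set_pmf_iff)
  define N where "N = restrict_space (measure_pmf \<mu>) (carrier G)"
  define P where "P = increment_space G \<mu>"
  have P_eq: "P = (\<Pi>\<^sub>M i\<in>UNIV. N)" by (simp add: P_def N_def increment_space_def)
  have space_N: "space N = carrier G" by (simp add: N_def space_restrict_space)
  have sets_N: "sets N = Pow (carrier G)"
    by (auto simp: N_def sets_restrict_space)
  have meas_N: "f \<in> measurable N K" if "f \<in> carrier G \<rightarrow> space K" for f :: "_ \<Rightarrow> 'b" and K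
    using that by (auto simp: measurable_def space_N sets_N)
  have AE_N: "(AE g in N. g \<in> A)"
    unfolding N_def by (subst AE_restrict_space_iff) (auto simp: AE_measure_pmf_iff A_def)
  have prob_N: "prob_space N"
    unfolding N_def
  proof (rule prob_space_restrict_space)
    have "emeasure (measure_pmf \<mu>) (carrier G) = emeasure (measure_pmf \<mu>) (space (measure_pmf \<mu>))"
      using A(2) by (intro emeasure_eq_AE) (auto simp: AE_measure_pmf_iff A_def)
    then show "emeasure (measure_pmf \<mu>) (carrier G) = 1"
      by (simp add: measure_pmf.emeasure_space_1)
  qed simp
  interpret P: prob_space P
    unfolding P_eq using prob_N by (intro prob_space_PiM)
  have int_N: "(\<integral>g. f g \<partial>N) = (\<Sum>g\<in>A. pmf \<mu> g * f g)" for f :: "_ \<Rightarrow> real"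
  proof -
    have "(\<integral>g. f g \<partial>N) = (\<integral>g. indicat_real (carrier G) g * f g \<partial>measure_pmf \<mu>)"
      unfolding N_def by (subst integral_restrict_space) auto
    also have "\<dots> = (\<Sum>g\<in>A. (indicat_real (carrier G) g * f g) * pmf \<mu> g)"
      by (rule integral_measure_pmf_real) (use A in \<open>auto simp: A_def\<close>)
    also have "\<dots> = (\<Sum>g\<in>A. pmf \<mu> g * f g)"
      using A(2) by (intro sum.cong) auto
    finally show ?thesis .
  qed
  define X where "X i \<omega> = real_of_int (snd (\<omega> i))" for i :: nat and \<omega> :: "nat \<Rightarrow> complex Matrix.vec \<times> int"
  define K where "K = 1 + (\<Sum>g\<in>A. \<bar>real_of_int (snd g)\<bar>)"
  define v where "v = (\<Sum>g\<in>A. pmf \<mu> g * (real_of_int (snd g))\<^sup>2)"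
  have comp: "(\<lambda>\<omega>. \<omega> i) \<in> measurable P N" for i
    unfolding P_eq by (rule measurable_component_singleton) simp
  have int_X: "(\<integral>\<omega>. f (\<omega> i) \<partial>P) = (\<Sum>g\<in>A. pmf \<mu> g * f g)" for f :: "_ \<Rightarrow> real" and i
  proof -
    have "distr P N (\<lambda>\<omega>. \<omega> i) = N"
      unfolding P_eq using prob_N by (intro distr_PiM_component) auto
    moreover have "(\<integral>g. f g \<partial>distr P N (\<lambda>\<omega>. \<omega> i)) = (\<integral>\<omega>. f (\<omega> i) \<partial>P)"
      by (rule integral_distr[OF comp meas_N]) auto
    ultimately show ?thesis by (simp add: int_N)
  qed
  have AE_A: "AE \<omega> in P. \<forall>i. \<omega> i \<in> A"
    unfolding AE_all_countable P_eq using prob_N AE_N by (auto intro: AE_PiM_component)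
  have walk_P: "centred_walk P X K v"
  proof
    have "P.indep_vars (\<lambda>_. N) (\<lambda>i \<omega>. \<omega> i) UNIV"
      unfolding P_eq by (rule indep_vars_PiM_component[OF prob_N])
    then show "P.indep_vars (\<lambda>_. borel) X UNIV"
      unfolding X_def by (rule P.indep_vars_compose2) (auto intro: meas_N)
    show "AE \<omega> in P. \<bar>X i \<omega>\<bar> \<le> K" for i
      using AE_A
    proof eventually_elim
      case (elim \<omega>)
      then have "\<bar>X i \<omega>\<bar> \<le> (\<Sum>g\<in>A. \<bar>real_of_int (snd g)\<bar>)"
        unfolding X_def using A by (intro member_le_sum) auto
      then show ?case by (simp add: K_def)
    qed
    show "K > 0" by (simp add: K_def add_pos_nonneg sum_nonneg)
    \<comment> \<open>Inversion permutes the support, preserves the weights and reverses the sign of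
      the projection.\<close>
    have "(\<Sum>g\<in>A. pmf \<mu> g * real_of_int (snd g)) = (\<Sum>g\<in>A. pmf \<mu> g * real_of_int (- snd g))"
    proof (rule sum.reindex_bij_witness[of _ "\<lambda>g. inv\<^bsub>G\<^esub> g" "\<lambda>g. inv\<^bsub>G\<^esub> g"])
      fix g assume "g \<in> A"
      moreover from this have "g \<in> carrier G" using A by blast
      ultimately show "inv\<^bsub>G\<^esub> (inv\<^bsub>G\<^esub> g) = g" "inv\<^bsub>G\<^esub> (inv\<^bsub>G\<^esub> g) = g" "inv\<^bsub>G\<^esub> g \<in> A" "inv\<^bsub>G\<^esub> g \<in> A"
        "pmf \<mu> (inv\<^bsub>G\<^esub> g) * real_of_int (- snd (inv\<^bsub>G\<^esub> g)) = pmf \<mu> g * real_of_int (snd g)"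
        using inv_A sym by (auto simp: snd_inv)
    qed
    also have "\<dots> = - (\<Sum>g\<in>A. pmf \<mu> g * real_of_int (snd g))"
      by (simp add: sum_negf)
    finally have "(\<Sum>g\<in>A. pmf \<mu> g * real_of_int (snd g)) = 0" by simp
    then show "P.expectation (X i) = 0" for i
      unfolding X_def using int_X[of "\<lambda>g. real_of_int (snd g)" i] by simp
    show "P.expectation (\<lambda>\<omega>. (X i \<omega>)\<^sup>2) = v" for i
      unfolding X_def v_def by (rule int_X)
    obtain s where s: "s \<in> A" "snd s \<noteq> 0"
      using snd_surjective_generators[OF A(3,2)] by blast
    then have "0 < pmf \<mu> s * (real_of_int (snd s))\<^sup>2"
      by (intro mult_pos_pos) (auto simp: A_def pmf_positive)
    also have "\<dots> \<le> v" unfolding v_def using s A by (intro member_le_sum) auto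
    finally show "v > 0" .
  qed
  have sum_X: "(\<Sum>i<n. X i \<omega>) = real_of_int (snd (walk G n \<omega>))" for n \<omega>
    by (simp add: X_def snd_walk)
  have closed: "walk G n \<omega> \<in> carrier G" if "\<omega> \<in> space P" for n \<omega>
    using that by (intro walk_closed) (auto simp: P_eq space_PiM space_N)
  show ?thesis
    unfolding has_escape_exponent_def Let_def P_def[symmetric]
  proof (intro allI impI)
    fix S assume S: "sym_gen_set G S"
    define L where "L n \<omega> = word_length G S (walk G n \<omega>)" for n \<omega>
    \<comment> \<open>Since the carrier is countable, it suffices to fix the value \<open>g\<close>
      of the walk; left multiplication by \<open>g\<close> is measurable on the discrete
      factor.\<close>
    have walk_meas: "walk G n \<in> measurable P (count_space (carrier G))" for n
    proof (induction n)
      case (Suc n)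
      have "(\<lambda>\<omega>. (\<lambda>g \<omega>. g \<otimes>\<^bsub>G\<^esub> \<omega> n) (walk G n \<omega>) \<omega>) \<in> measurable P (count_space (carrier G))"
      proof (rule measurable_compose_countable'[OF _ Suc countable_carrier[OF S]])
        fix g assume "g \<in> carrier G"
        then have "(\<lambda>h. g \<otimes>\<^bsub>G\<^esub> h) \<in> measurable N (count_space (carrier G))"
          by (intro meas_N) auto
        then show "(\<lambda>\<omega>. g \<otimes>\<^bsub>G\<^esub> \<omega> n) \<in> measurable P (count_space (carrier G))"
          by (rule measurable_compose[OF comp])
      qed
      then show ?case by simp
    qed simp
    obtain a where a: "a > 0" "\<And>g. g \<in> carrier G \<Longrightarrow> real_of_int \<bar>snd g\<bar> \<le> a * real (word_length G S g)"
      using word_length_lower[OF S] by blast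
    obtain b :: real where b: "b > 0" "\<forall>n \<omega> R. (\<forall>i<n. \<omega> i \<in> A) \<longrightarrow> (\<forall>k\<le>n. \<bar>snd (walk G k \<omega>)\<bar> \<le> R) \<longrightarrow>
        real (word_length G S (walk G n \<omega>)) \<le> b * (real_of_int R + sqrt n + 1)"
      using word_length_walk_upper[OF S A(1,2) q] by (elim exE conjE)
    interpret escape_comparison P X K v L a b
    proof (intro escape_comparison.intro walk_P escape_comparison_axioms.intro)
      show "(\<lambda>\<omega>. real (L n \<omega>)) \<in> borel_measurable P" for n
        unfolding L_def by (rule measurable_compose[OF walk_meas]) simp
      show "L 0 \<omega> = 0" if "\<omega> \<in> space P" for \<omega>
        by (simp add: L_def)
      show "\<bar>\<Sum>i<n. X i \<omega>\<bar> \<le> a * real (L n \<omega>)" if "\<omega> \<in> space P" for \<omega> n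
        using a(2)[OF closed[OF that]] by (simp add: sum_X L_def)
      show "AE \<omega> in P. \<forall>n r. (\<forall>k\<le>n. \<bar>\<Sum>i<k. X i \<omega>\<bar> \<le> r) \<longrightarrow> real (L n \<omega>) \<le> b * (r + sqrt n + 1)"
        using AE_A
      proof eventually_elim
        case (elim \<omega>)
        show ?case
        proof (intro allI impI)
          fix n r assume r: "\<forall>k\<le>n. \<bar>\<Sum>i<k. X i \<omega>\<bar> \<le> r"
          \<comment> \<open>The pathwise bound takes an integer radius; the projection is integer
            valued, so a real bound may be rounded down.\<close>
          have "\<bar>snd (walk G k \<omega>)\<bar> \<le> \<lfloor>r\<rfloor>" if "k \<le> n" for k
          proof -
            have "real_of_int \<bar>snd (walk G k \<omega>)\<bar> \<le> r" using r that by (simp add: sum_X)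
            then show ?thesis by (simp add: le_floor_iff)
          qed
          then have "real (L n \<omega>) \<le> b * (real_of_int \<lfloor>r\<rfloor> + sqrt n + 1)"
            unfolding L_def using b(2) elim by blast
          also have "\<dots> \<le> b * (r + sqrt n + 1)" using b(1) by (intro mult_left_mono) auto
          finally show "real (L n \<omega>) \<le> b * (r + sqrt n + 1)" .
        qed
      qed
    qed (use a b in auto)
    show "tight_degree_of_escape P (\<lambda>n \<omega>. word_length G S (walk G n \<omega>)) (1/2) \<and>
        displacement_exponent P (\<lambda>n \<omega>. word_length G S (walk G n \<omega>)) (1/2) \<and>
        iterated_log_law P (\<lambda>n \<omega>. word_length G S (walk G n \<omega>)) (1/2)"
      using tight_degree_of_escape_L displacement_exponent_L iterated_log_law_L
      unfolding L_def by blast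
  qed
qed

end

theorem theorem2:
  fixes \<rho> :: complex and d :: nat and \<phi> :: "complex Matrix.vec \<Rightarrow> complex Matrix.vec"
  assumes "algebraic \<rho>"
    and "d \<ge> 1"
    and "linear_automorphism \<rho> d \<phi>"
    and "fin_generated (semidirect \<rho> d \<phi>)"
    and "\<exists>q. integral_multiple (char_poly_of d \<phi>) q \<and> EDP q"
  shows "\<exists>\<mu>. adapted (semidirect \<rho> d \<phi>) \<mu> \<and> has_escape_exponent (semidirect \<rho> d \<phi>) \<mu> (1/2)"
proof -
  interpret free_mod_automorphism \<rho> d \<phi> by unfold_locales (rule assms)
  interpret group G by (rule group_G)
  obtain S where S: "sym_gen_set G S" using fin_generated_sym_gen_set[OF assms(4)] by blast
  have "S \<noteq> {}"
    using snd_surjective_generators[of S] S by (auto simp: sym_gen_set_def)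
  then have "adapted G (pmf_of_set S)" by (rule sym_gen_set_adapted[OF S])
  moreover obtain q where "integral_multiple (char_poly_of d \<phi>) q" "EDP q"
    using assms(5) by blast
  ultimately show ?thesis
    by (intro exI[of _ "pmf_of_set S"] conjI adapted_has_escape_exponent)
qed

end
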